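(* Let $d\ge 2$, let $\Gamma=(V,\mathcal E)$ be a $\mathbb Z^d$-periodic graph with fundamental graph $\Gamma_f$ on the vertices $v_1,\ldots,v_\nu$, and let $H=\Delta+Q$ be the Schrödinger operator on $\ell^2(V)$ with a real $\mathbb Z^d$-periodic potential $Q$, $q_j=Q(v_j)$. Then: (i) There is a unitary operator $U:\ell^2(V)\to\frac1{(2\pi)^d}\int^\oplus_{\mathbb T^d}\mathbb C^\nu\,d\vartheta=L^2\big(\mathbb T^d,\tfrac{d\vartheta}{(2\pi)^d};\mathbb C^\nu\big)$ such that $UHU^{-1}=\frac1{(2\pi)^d}\int^\oplus_{\mathbb T^d}H(\vartheta)\,d\vartheta$ (i.e. $UHU^{-1}$ is multiplication by the matrix-valued function $H(\cdot)$), where for all $\vartheta\in\mathbb T^d$ the Floquet $\nu\times\nu$ matrix is $$H(\vartheta)=\Delta(\vartheta)+q,\qquad q=\mathrm{diag}(q_1,\ldots,q_\nu),$$ and the Floquet matrix $\Delta(\vartheta)=\{\Delta_{jk}(\vartheta)\}_{j,k=1}^\nu$ of the Laplacian is $$\Delta_{jk}(\vartheta)=\varkappa_j\delta_{jk}-\begin{cases}\displaystyle\sum_{\mathbf e=(v_j,v_k)\in\mathcal A_f}e^{\,i\langle\tau(\mathbf e),\vartheta\rangle},&\text{if }(v_j,v_k)\in\mathcal A_f,\\ 0,&\text{if }(v_j,v_k)\notin\mathcal A_f,\end{cases}$$ where $\varkappa_j$ is the degree of $v_j$, $\delta_{jk}$ is the Kronecker delta, and $\langle\cdot,\cdot\rangle$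 is the standard inner product in $\mathbb R^d$. (ii) Let $H^{(1)}(\vartheta)$ be the Floquet matrix of $H$ defined by the same formulas in another coordinate system with an origin $O_1$ (with axes along the same periods). Then $H^{(1)}(\vartheta)$ and $H(\vartheta)$ are unitarily equivalent for all $\vartheta\in\mathbb T^d$. (iii) For each $j,k$, the entry $\Delta_{jk}(\cdot)$ is constant on $\mathbb T^d$ if and only if there is no bridge $(v_j,v_k)\in\mathcal A_f$. (iv) The matrix $\Delta(\cdot)$ has at least one non-constant entry $\Delta_{jk}(\cdot)$ for some $j\le k$.
   Context: A $\mathbb Z^d$-periodic graph $\Gamma=(V,\mathcal E)$ ($d\ge2$) is a connected graph embedded in $\mathbb R^d$, possibly with loops and multiple edges, with vertex set $V$ and set $\mathcal E$ of unoriented edges, such that: any bounded domain of $\mathbb R^d$ contains finitely many vertices; every vertex has finite degree (number of incident edges, a loop counted twice); and there is a basis $a_1,\ldots,a_d$ of $\mathbb R^d$ (the periods) with $\Gamma+a_s=\Gamma$ for $s=1,\ldots,d$. Coordinates are taken with some origin $O$ and axes along $a_1,\ldots,a_d$, so that $\Gamma+m=\Gamma$ for all $m\in\mathbb Z^d$. Each unoriented edge gives two oriented edges $(u,v)$ and $(v,u)$ (in particular an unoriented loop gives two oriented loops); $\mathcal A$ is the set of oriented edges of $\Gamma$. The fundamental graph is $\Gamma_f=\Gamma/\mathbb Z^d$; it is finite, its vertices are identified with $V\cap[0,1)^d=\{v_1,\ldots,v_\nu\}$, and $\mathcal A_f=\mathcal A/\mathbb Z^d$ is its set of oriented edges. Every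 $v\in V$ is uniquely $v=[v]+\tilde v$ with $[v]\in\mathbb Z^d$, $\tilde v\in V\cap[0,1)^d$. The index of $\mathbf e=(u,v)\in\mathcal A$ is $\tau(\mathbf e)=[v]-[u]\in\mathbb Z^d$; it is invariant under translations by $\mathbb Z^d$ and so defines the index of the corresponding edge of $\mathcal A_f$. An edge of $\mathcal A_f$ with nonzero index is called a bridge. Changing the origin keeps the $\mathbb Z^d$-orbits of vertices and edges (and their numbering), but may change the indices. The Laplacian on $\ell^2(V)$ is $(\Delta f)(v)=\sum_{(v,u)_e\in\mathcal E}(f(v)-f(u))$ (sum over unoriented edges incident to $v$). The potential satisfies $Q(v+m)=Q(v)\in\mathbb R$ for $v\in V,m\in\mathbb Z^d$, and $(Qf)(v)=Q(v)f(v)$. $\mathbb T^d=\mathbb R^d/(2\pi\mathbb Z)^d$. *)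

theory Defs
  imports "HOL-Analysis.Analysis" "Graph_Theory.Graph_Theory"
begin

section \<open>Periods and coordinates\<close>

definition lattice_vec :: "('d \<Rightarrow> real^'d) \<Rightarrow> int^'d \<Rightarrow> real^'d" where
  "lattice_vec a m = (\<Sum>s\<in>UNIV. of_int (m $ s) *\<^sub>R a s)"

text \<open>Coordinates with respect to the origin \<open>p\<close> and the axes \<open>a s\<close>. All functions below take
  the origin as an argument, since the indices of edges depend on it.\<close>

definition coords :: "('d \<Rightarrow> real^'d) \<Rightarrow> real^'d \<Rightarrow> real^'d \<Rightarrow> real^'d" where
  "coords a p x = (THE c. x = p + (\<Sum>s\<in>UNIV. (c $ s) *\<^sub>R a s))"

definition cell :: "('d \<Rightarrow> real^'d) \<Rightarrow> real^'d \<Rightarrow> (real^'d) set" where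
  "cell a p = {x. \<forall>s. 0 \<le> coords a p x $ s \<and> coords a p x $ s < 1}"

text \<open>The decomposition of a point \<open>x\<close> into \<open>[x]\<close> and its representative in the cell.\<close>

definition int_part :: "('d \<Rightarrow> real^'d) \<Rightarrow> real^'d \<Rightarrow> real^'d \<Rightarrow> int^'d" where
  "int_part a p x = (\<chi> s. \<lfloor>coords a p x $ s\<rfloor>)"

definition cell_part :: "('d \<Rightarrow> real^'d) \<Rightarrow> real^'d \<Rightarrow> real^'d \<Rightarrow> real^'d" where
  "cell_part a p x = x - lattice_vec a (int_part a p x)"


section \<open>Periodic graphs\<close>

text \<open>The arcs of \<open>G\<close> are the oriented edges, \<open>arev\<close> is the fixed-point free reversal of
  orientation (so an unoriented loop is a pair of distinct oriented loops), and an unoriented edge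
  is a set \<open>{e, arev e}\<close>. Because of multiple edges, the translate of an edge is not determined
  by the translates of its ends; \<open>shift m e\<close> is the translate of the oriented edge \<open>e\<close> by the
  lattice vector \<open>m\<close>.\<close>

locale periodic_graph = bidirected_digraph G arev
  for G :: "(real^'d, 'e) pre_digraph" and arev :: "'e \<Rightarrow> 'e" +
  fixes a :: "'d \<Rightarrow> real^'d" and shift :: "int^'d \<Rightarrow> 'e \<Rightarrow> 'e"
  assumes connected: "Digraph_Component.connected G"
    and locally_finite: "\<And>B. bounded B \<Longrightarrow> finite (verts G \<inter> B)"
    and finite_degree: "\<And>v. v \<in> verts G \<Longrightarrow> finite {e \<in> arcs G. v \<in> {tail G e, head G e}}"
    and basis: "inj a" "independent (range a)" "span (range a) = UNIV"
    and verts_shift: "\<And>m v. v \<in> verts G \<Longrightarrow> v + lattice_vec a m \<in> verts G"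
    and arcs_shift: "\<And>m e. e \<in> arcs G \<Longrightarrow> shift m e \<in> arcs G"
    and shift_zero: "\<And>e. e \<in> arcs G \<Longrightarrow> shift 0 e = e"
    and shift_add: "\<And>m n e. e \<in> arcs G \<Longrightarrow> shift (m + n) e = shift m (shift n e)"
    and tail_shift: "\<And>m e. e \<in> arcs G \<Longrightarrow> tail G (shift m e) = tail G e + lattice_vec a m"
    and head_shift: "\<And>m e. e \<in> arcs G \<Longrightarrow> head G (shift m e) = head G e + lattice_vec a m"
    and arev_shift: "\<And>m e. e \<in> arcs G \<Longrightarrow> arev (shift m e) = shift m (arev e)"

definition unoriented_edges :: "('v, 'e) pre_digraph \<Rightarrow> ('e \<Rightarrow> 'e) \<Rightarrow> 'e set set" where
  "unoriented_edges G arev = (\<lambda>e. {e, arev e}) ` arcs G"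

text \<open>The set of end points of an unoriented edge \<open>E\<close> is \<open>tail G ` E\<close>.\<close>

definition incident_edges :: "('v, 'e) pre_digraph \<Rightarrow> ('e \<Rightarrow> 'e) \<Rightarrow> 'v \<Rightarrow> 'e set set" where
  "incident_edges G arev v = {E \<in> unoriented_edges G arev. v \<in> tail G ` E}"

definition loops_at :: "('v, 'e) pre_digraph \<Rightarrow> ('e \<Rightarrow> 'e) \<Rightarrow> 'v \<Rightarrow> 'e set set" where
  "loops_at G arev v = {E \<in> unoriented_edges G arev. tail G ` E = {v}}"

definition degree :: "('v, 'e) pre_digraph \<Rightarrow> ('e \<Rightarrow> 'e) \<Rightarrow> 'v \<Rightarrow> nat" where
  "degree G arev v = card (incident_edges G arev v) + card (loops_at G arev v)"

definition other_end :: "('v, 'e) pre_digraph \<Rightarrow> 'e set \<Rightarrow> 'v \<Rightarrow> 'v" where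
  "other_end G E v = (THE u. tail G ` E = {v, u})"


section \<open>The fundamental graph\<close>

definition arc_orbit :: "(int^'d \<Rightarrow> 'e \<Rightarrow> 'e) \<Rightarrow> 'e \<Rightarrow> 'e set" where
  "arc_orbit shift e = range (\<lambda>m. shift m e)"

definition fundamental_graph ::
    "(real^'d, 'e) pre_digraph \<Rightarrow> ('d \<Rightarrow> real^'d) \<Rightarrow> (int^'d \<Rightarrow> 'e \<Rightarrow> 'e) \<Rightarrow> real^'d
      \<Rightarrow> (real^'d, 'e set) pre_digraph" where
  "fundamental_graph G a shift p =
    \<lparr> verts = verts G \<inter> cell a p,
      arcs = arc_orbit shift ` arcs G,
      tail = (\<lambda>E. the_elem ((\<lambda>e. cell_part a p (tail G e)) ` E)),
      head = (\<lambda>E. the_elem ((\<lambda>e. cell_part a p (head G e)) ` E)) \<rparr>"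

definition edge_index ::
    "(real^'d, 'e) pre_digraph \<Rightarrow> ('d \<Rightarrow> real^'d) \<Rightarrow> real^'d \<Rightarrow> 'e \<Rightarrow> int^'d" where
  "edge_index G a p e = int_part a p (head G e) - int_part a p (tail G e)"

definition orbit_index ::
    "(real^'d, 'e) pre_digraph \<Rightarrow> ('d \<Rightarrow> real^'d) \<Rightarrow> real^'d \<Rightarrow> 'e set \<Rightarrow> int^'d" where
  "orbit_index G a p E = the_elem (edge_index G a p ` E)"

definition arcs_between :: "('v, 'e) pre_digraph \<Rightarrow> 'v \<Rightarrow> 'v \<Rightarrow> 'e set" where
  "arcs_between G u v = {e \<in> arcs G. tail G e = u \<and> head G e = v}"

text \<open>The values picked out by \<open>THE\<close> and \<open>the_elem\<close> exist: coordinates are unique, and ends and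
  indices are the same for all edges in an orbit.\<close>

context periodic_graph
begin

lemma coords_eq: "coords a p (p + (\<Sum>s\<in>UNIV. (c $ s) *\<^sub>R a s)) = c"
proof -
  have inj: "c = c'" if "(\<Sum>s\<in>UNIV. (c $ s) *\<^sub>R a s) = (\<Sum>s\<in>UNIV. (c' $ s) *\<^sub>R a s)"
    for c c' :: "real^'d"
  proof -
    have "(\<Sum>x\<in>range a. ((c - c') $ inv a x) *\<^sub>R x) = (\<Sum>s\<in>UNIV. ((c - c') $ s) *\<^sub>R a s)"
      using basis(1) by (simp add: sum.reindex)
    also have "\<dots> = 0"
      using that by (simp add: scaleR_left_diff_distrib sum_subtractf)
    finally have *: "(\<Sum>x\<in>range a. ((c - c') $ inv a x) *\<^sub>R x) = 0" .
    have "(c - c') $ inv a x = 0" if "x \<in> range a" for x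
      using independentD[OF basis(2) _ subset_refl * that] by simp
    then have "(c - c') $ s = 0" for s
      using basis(1) by (metis inv_f_f rangeI)
    then show ?thesis
      by (simp add: vec_eq_iff)
  qed
  show ?thesis
    unfolding coords_def by (rule the_equality) (auto dest: inj)
qed

lemma coords_sum: "p + (\<Sum>s\<in>UNIV. (coords a p x $ s) *\<^sub>R a s) = x"
proof -
  have "x - p \<in> span (range a)"
    using basis(3) by simp
  then obtain u where "x - p = (\<Sum>y\<in>range a. u y *\<^sub>R y)"
    by (auto simp: span_finite)
  then have "x = p + (\<Sum>s\<in>UNIV. ((\<chi> s. u (a s)) $ s) *\<^sub>R a s)"
    using basis(1) by (simp add: sum.reindex algebra_simps)
  then show ?thesis
    by (metis coords_eq)
qed

lemma coords_add_lattice: "coords a p (x + lattice_vec a m) = coords a p x + (\<chi> s. of_int (m $ s))"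
proof -
  have "x + lattice_vec a m
      = p + (\<Sum>s\<in>UNIV. ((coords a p x + (\<chi> s. of_int (m $ s))) $ s) *\<^sub>R a s)"
    by (subst (1) coords_sum[of p x, symmetric])
      (simp add: lattice_vec_def scaleR_left_distrib sum.distrib)
  then show ?thesis
    by (metis coords_eq)
qed

lemma int_part_add_lattice: "int_part a p (x + lattice_vec a m) = int_part a p x + m"
  by (simp add: int_part_def coords_add_lattice vec_eq_iff)

lemma cell_part_add_lattice: "cell_part a p (x + lattice_vec a m) = cell_part a p x"
  by (simp add: cell_part_def int_part_add_lattice)
    (simp add: lattice_vec_def scaleR_left_distrib sum.distrib)

lemma
  assumes "e \<in> arcs G"
  shows tail_fundamental_graph:
      "tail (fundamental_graph G a shift p) (arc_orbit shift e) = cell_part a p (tail G e)"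
    and head_fundamental_graph:
      "head (fundamental_graph G a shift p) (arc_orbit shift e) = cell_part a p (head G e)"
    and orbit_index_eq: "orbit_index G a p (arc_orbit shift e) = edge_index G a p e"
  using assms
  by (simp_all add: fundamental_graph_def orbit_index_def edge_index_def arc_orbit_def image_image
      tail_shift head_shift cell_part_add_lattice int_part_add_lattice)

lemma other_end_eq:
  assumes "e \<in> arcs G"
  shows "other_end G {e, arev e} (tail G e) = head G e"
  using assms unfolding other_end_def by (intro the_equality) (auto simp: doubleton_eq_iff)

end


section \<open>Floquet matrices\<close>

text \<open>The vertices of the fundamental graph are numbered by \<open>v\<close> with indices in a finite linearly
  ordered type \<open>'n\<close>. The sum over the arcs is 0 if there are none.\<close>

definition floquet_laplacian ::
    "(real^'d, 'e) pre_digraph \<Rightarrow> ('e \<Rightarrow> 'e) \<Rightarrow> ('d \<Rightarrow> real^'d) \<Rightarrow> (int^'d \<Rightarrow> 'e \<Rightarrow> 'e)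
      \<Rightarrow> real^'d \<Rightarrow> ('n \<Rightarrow> real^'d) \<Rightarrow> real^'d \<Rightarrow> complex^'n^'n" where
  "floquet_laplacian G arev a shift p v \<theta> =
    (\<chi> j k. (if j = k then of_nat (degree G arev (v j)) else 0)
      - (\<Sum>E\<in>arcs_between (fundamental_graph G a shift p) (v j) (v k).
           exp (\<i> * complex_of_real ((\<chi> s. real_of_int (orbit_index G a p E $ s)) \<bullet> \<theta>))))"

definition floquet_matrix ::
    "(real^'d, 'e) pre_digraph \<Rightarrow> ('e \<Rightarrow> 'e) \<Rightarrow> ('d \<Rightarrow> real^'d) \<Rightarrow> (int^'d \<Rightarrow> 'e \<Rightarrow> 'e)
      \<Rightarrow> (real^'d \<Rightarrow> real) \<Rightarrow> real^'d \<Rightarrow> ('n \<Rightarrow> real^'d) \<Rightarrow> real^'d \<Rightarrow> complex^'n^'n" where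
  "floquet_matrix G arev a shift Q p v \<theta> =
    floquet_laplacian G arev a shift p v \<theta>
      + (\<chi> j k. if j = k then complex_of_real (Q (v j)) else 0)"

definition conj_transpose :: "complex^'n^'n \<Rightarrow> complex^'n^'n" where
  "conj_transpose A = (\<chi> j k. cnj (A $ k $ j))"

definition unitarily_equivalent :: "complex^'n^'n \<Rightarrow> complex^'n^'n \<Rightarrow> bool" where
  "unitarily_equivalent A B \<longleftrightarrow>
    (\<exists>W. W ** conj_transpose W = mat 1 \<and> conj_transpose W ** W = mat 1
       \<and> B = W ** A ** conj_transpose W)"


section \<open>The Schroedinger operator\<close>

text \<open>Functions on \<open>V\<close> are extended by 0 outside \<open>V\<close>.\<close>

definition ell2 :: "'v set \<Rightarrow> ('v \<Rightarrow> complex) set" where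
  "ell2 V = {f. (\<forall>x. x \<notin> V \<longrightarrow> f x = 0) \<and> (\<lambda>x. (cmod (f x))\<^sup>2) summable_on V}"

definition ell2_inner :: "'v set \<Rightarrow> ('v \<Rightarrow> complex) \<Rightarrow> ('v \<Rightarrow> complex) \<Rightarrow> complex" where
  "ell2_inner V f g = infsum (\<lambda>x. f x * cnj (g x)) V"

definition laplacian ::
    "('v, 'e) pre_digraph \<Rightarrow> ('e \<Rightarrow> 'e) \<Rightarrow> ('v \<Rightarrow> complex) \<Rightarrow> 'v \<Rightarrow> complex" where
  "laplacian G arev f v = (\<Sum>E\<in>incident_edges G arev v. f v - f (other_end G E v))"

definition schroedinger ::
    "('v, 'e) pre_digraph \<Rightarrow> ('e \<Rightarrow> 'e) \<Rightarrow> ('v \<Rightarrow> real) \<Rightarrow> ('v \<Rightarrow> complex) \<Rightarrow> 'v \<Rightarrow> complex"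
  where
  "schroedinger G arev Q f v = laplacian G arev f v + complex_of_real (Q v) * f v"


section \<open>The constant fibre direct integral over the torus\<close>

text \<open>The torus is represented by the cube \<open>[0,2\<pi>)\<^sup>d\<close>.\<close>

definition torus :: "(real^'d) set" where
  "torus = {\<theta>. \<forall>s. 0 \<le> \<theta> $ s \<and> \<theta> $ s < 2 * pi}"

definition torus_measure :: "(real^'d) measure" where
  "torus_measure = density (restrict_space lborel torus) (\<lambda>_. ennreal (1 / (2 * pi) ^ CARD('d)))"

text \<open>Elements of \<open>L\<^sup>2\<close> are represented by functions; they are equal if they agree almost
  everywhere.\<close>

definition L2 :: "(real^'d \<Rightarrow> complex^'n) set" where
  "L2 = {g \<in> borel_measurable torus_measure. integrable torus_measure (\<lambda>\<theta>. (norm (g \<theta>))\<^sup>2)}"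

definition L2_inner :: "(real^'d \<Rightarrow> complex^'n) \<Rightarrow> (real^'d \<Rightarrow> complex^'n) \<Rightarrow> complex" where
  "L2_inner g h = (\<integral>\<theta>. (\<Sum>j\<in>UNIV. g \<theta> $ j * cnj (h \<theta> $ j)) \<partial>torus_measure)"

definition L2_eq :: "(real^'d \<Rightarrow> complex^'n) \<Rightarrow> (real^'d \<Rightarrow> complex^'n) \<Rightarrow> bool" where
  "L2_eq g h \<longleftrightarrow> (AE \<theta> in torus_measure. g \<theta> = h \<theta>)"

definition unitary_ell2_L2 ::
    "'v set \<Rightarrow> (('v \<Rightarrow> complex) \<Rightarrow> real^'d \<Rightarrow> complex^'n) \<Rightarrow> bool" where
  "unitary_ell2_L2 V U \<longleftrightarrow>
    (\<forall>f\<in>ell2 V. U f \<in> L2) \<and>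
    (\<forall>f\<in>ell2 V. \<forall>g\<in>ell2 V. L2_eq (U (\<lambda>x. f x + g x)) (\<lambda>\<theta>. U f \<theta> + U g \<theta>)) \<and>
    (\<forall>c. \<forall>f\<in>ell2 V. L2_eq (U (\<lambda>x. c * f x)) (\<lambda>\<theta>. c *s U f \<theta>)) \<and>
    (\<forall>f\<in>ell2 V. \<forall>g\<in>ell2 V. L2_inner (U f) (U g) = ell2_inner V f g) \<and>
    (\<forall>h\<in>L2. \<exists>f\<in>ell2 V. L2_eq (U f) h)"

definition inverse_op ::
    "'v set \<Rightarrow> (('v \<Rightarrow> complex) \<Rightarrow> real^'d \<Rightarrow> complex^'n) \<Rightarrow> (real^'d \<Rightarrow> complex^'n)
      \<Rightarrow> 'v \<Rightarrow> complex" where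
  "inverse_op V U h = (THE f. f \<in> ell2 V \<and> L2_eq (U f) h)"

text \<open>The direct integral of the operators \<open>A \<theta>\<close>.\<close>

definition direct_integral_op ::
    "(real^'d \<Rightarrow> complex^'n^'n) \<Rightarrow> (real^'d \<Rightarrow> complex^'n) \<Rightarrow> real^'d \<Rightarrow> complex^'n" where
  "direct_integral_op A g = (\<lambda>\<theta>. A \<theta> *v g \<theta>)"

end

theory Submission
  imports Defs
begin

text \<open>Let \<open>U f\<close> be the vector with components \<open>\<Sum>m. exp (- \<i> * \<langle>m, \<theta>\<rangle>) * f (v j + m)\<close>. It is unitary since the
  characters form an orthonormal basis of \<open>L\<^sup>2\<close> of the torus. The arcs from \<open>v j + m\<close> are the translates by
  \<open>m\<close> of the arcs from \<open>v j\<close>; an arc from \<open>v j\<close> to \<open>v k + \<tau>\<close> contributes \<open>f (v k + \<tau> + m)\<close>, the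
  \<open>m\<close>-th Fourier coefficient of \<open>exp (\<i> * \<langle>\<tau>, \<theta>\<rangle>) * (U f) k\<close>. A change of origin conjugates \<open>H \<theta>\<close> by a
  diagonal matrix of characters. A sum of \<open>N\<close> characters has the value \<open>N\<close> at 0 and a smaller real part
  somewhere unless all characters are trivial. Without bridges, no path could leave the cell.\<close>

section \<open>Orthonormal families of square integrable functions\<close>

text \<open>The series for \<open>U f\<close> need not converge absolutely, so its values at points
  are not directly available. The Riesz-Fischer theorem supplies square integrable functions with
  the prescribed Fourier coefficients, and a choice among them defines the transform. From then on
  every claim about it is checked on Fourier coefficients, which determine an element of
  \<open>L2\<close> up to null sets: linearity, surjectivity, the inverse, the intertwining
  relation, and even the fact that the Schroedinger operator preserves \<open>ell2\<close>.
  Completeness of the characters is the analytic core. The half-open cube is not compact, and on its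
  closure the characters do not separate opposite faces. The cube is therefore wrapped onto a
  product of circles, where Stone-Weierstrass applies; a Borel left inverse of the wrapping brings
  the conclusion back to all Borel subsets of the cube. The order \<open>j \<le> k\<close> in the
  last claim costs nothing: reversing an arc negates its index and exchanges its ends, so bridges
  come in opposite pairs.\<close>

definition square_integrable :: "'a measure \<Rightarrow> ('a \<Rightarrow> complex) \<Rightarrow> bool" where
  "square_integrable M f \<longleftrightarrow> f \<in> borel_measurable M \<and> integrable M (\<lambda>x. (cmod (f x))\<^sup>2)"

lemma square_integrable_measurable[measurable_dest]:
  "square_integrable M f \<Longrightarrow> f \<in> borel_measurable M"
  by (simp add: square_integrable_def)

lemma square_integrableD: "square_integrable M f \<Longrightarrow> integrable M (\<lambda>x. (cmod (f x))\<^sup>2)"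
  by (simp add: square_integrable_def)

lemma cmod_add_square_le: "(cmod (x + y))\<^sup>2 \<le> 2 * (cmod x)\<^sup>2 + 2 * (cmod y)\<^sup>2"
proof -
  have "(cmod (x + y))\<^sup>2 \<le> (cmod x + cmod y)\<^sup>2"
    by (simp add: norm_triangle_ineq power_mono)
  also have "\<dots> \<le> 2 * (cmod x)\<^sup>2 + 2 * (cmod y)\<^sup>2"
    using sum_squares_bound[of "cmod x" "cmod y"] by (simp add: power2_sum)
  finally show ?thesis .
qed

lemma square_integrable_add:
  assumes "square_integrable M f" "square_integrable M g"
  shows "square_integrable M (\<lambda>x. f x + g x)"
proof -
  have [measurable]: "f \<in> borel_measurable M" "g \<in> borel_measurable M"
    using assms by (auto simp: square_integrable_def)
  have "integrable M (\<lambda>x. 2 * (cmod (f x))\<^sup>2 + 2 * (cmod (g x))\<^sup>2)"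
    using assms by (auto simp: square_integrable_def)
  then have "integrable M (\<lambda>x. (cmod (f x + g x))\<^sup>2)"
    by (rule Bochner_Integration.integrable_bound) (auto intro!: AE_I2 cmod_add_square_le order_trans[OF _ abs_ge_self])
  then show ?thesis
    by (simp add: square_integrable_def)
qed

lemma square_integrable_cmult: "square_integrable M f \<Longrightarrow> square_integrable M (\<lambda>x. c * f x)"
  by (auto simp: square_integrable_def norm_mult power_mult_distrib)

lemma square_integrable_zero: "square_integrable M (\<lambda>x. 0)"
  by (simp add: square_integrable_def)

lemma square_integrable_diff:
  assumes "square_integrable M f" "square_integrable M g"
  shows "square_integrable M (\<lambda>x. f x - g x)"
  using square_integrable_add[OF assms(1) square_integrable_cmult[OF assms(2), of "-1"]] by simp

lemma square_integrable_sum: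
  "(\<And>i. i \<in> F \<Longrightarrow> square_integrable M (f i)) \<Longrightarrow> square_integrable M (\<lambda>x. \<Sum>i\<in>F. f i x)"
  by (induction F rule: infinite_finite_induct)
    (auto intro: square_integrable_zero square_integrable_add)

lemma borel_measurable_cnj: "cnj \<in> borel_measurable borel"
  by (intro borel_measurable_continuous_onI continuous_intros)

lemma integrable_mult_cnj:
  assumes "square_integrable M f" "square_integrable M g"
  shows "integrable M (\<lambda>x. f x * cnj (g x))"
proof -
  have [measurable]: "f \<in> borel_measurable M" "g \<in> borel_measurable M"
    using assms by (auto simp: square_integrable_def)
  have "integrable M (\<lambda>x. (cmod (f x))\<^sup>2 + (cmod (g x))\<^sup>2)"
    using assms by (auto simp: square_integrable_def)
  moreover have "cmod (f x) * cmod (g x) \<le> (cmod (f x))\<^sup>2 + (cmod (g x))\<^sup>2" for x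
    using sum_squares_bound[of "cmod (f x)" "cmod (g x)"]
    using mult_nonneg_nonneg[OF norm_ge_zero[of "f x"] norm_ge_zero[of "g x"]]
    unfolding mult.assoc by linarith
  moreover have "(\<lambda>x. f x * cnj (g x)) \<in> borel_measurable M"
    by (intro borel_measurable_times measurable_compose[OF _ borel_measurable_cnj]) fact+
  ultimately show ?thesis
    by (elim Bochner_Integration.integrable_bound) (auto simp: norm_mult)
qed

lemma integral_cmod_square_eq:
  "complex_of_real (\<integral>x. (cmod (f x))\<^sup>2 \<partial>M) = (\<integral>x. f x * cnj (f x) \<partial>M)"
  unfolding integral_complex_of_real[symmetric] by (intro Bochner_Integration.integral_cong) (simp_all add: complex_norm_square del: of_real_power)

lemma integral_cmod_square_diff:
  assumes f: "square_integrable M f" and g: "square_integrable M g"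
  shows "(\<integral>x. (cmod (f x - g x))\<^sup>2 \<partial>M)
    = (\<integral>x. (cmod (f x))\<^sup>2 \<partial>M) - 2 * Re (\<integral>x. f x * cnj (g x) \<partial>M) + (\<integral>x. (cmod (g x))\<^sup>2 \<partial>M)"
proof -
  note [simp] = square_integrableD[OF f] square_integrableD[OF g] integrable_mult_cnj[OF f g]
  have "(cmod (a - b))\<^sup>2 = (cmod a)\<^sup>2 - 2 * Re (a * cnj b) + (cmod b)\<^sup>2" for a b
    unfolding cmod_power2 by (simp add: power2_eq_square algebra_simps)
  then have "(\<integral>x. (cmod (f x - g x))\<^sup>2 \<partial>M)
      = (\<integral>x. (cmod (f x))\<^sup>2 - 2 * Re (f x * cnj (g x)) + (cmod (g x))\<^sup>2 \<partial>M)"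
    by (simp only:)
  also have "\<dots> = (\<integral>x. (cmod (f x))\<^sup>2 - 2 * Re (f x * cnj (g x)) \<partial>M) + (\<integral>x. (cmod (g x))\<^sup>2 \<partial>M)"
    by (rule Bochner_Integration.integral_add)
      (intro Bochner_Integration.integrable_diff integrable_mult_right integrable_Re | simp)+
  also have "(\<integral>x. (cmod (f x))\<^sup>2 - 2 * Re (f x * cnj (g x)) \<partial>M)
      = (\<integral>x. (cmod (f x))\<^sup>2 \<partial>M) - (\<integral>x. 2 * Re (f x * cnj (g x)) \<partial>M)"
    by (rule Bochner_Integration.integral_diff)
      (intro integrable_mult_right integrable_Re | simp)+
  also have "(\<integral>x. 2 * Re (f x * cnj (g x)) \<partial>M) = 2 * Re (\<integral>x. f x * cnj (g x) \<partial>M)"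
    by (subst integral_Re[symmetric]) (simp_all only: integral_mult_right_zero integrable_mult_cnj[OF f g])
  finally show ?thesis .
qed

section \<open>Bessel's inequality and the Riesz-Fischer theorem\<close>

locale orthonormal_family = finite_measure M for M :: "'a measure" +
  fixes e :: "'i \<Rightarrow> 'a \<Rightarrow> complex"
  assumes square_integrable_family: "square_integrable M (e i)"
    and orthonormal: "(\<integral>x. e i x * cnj (e j x) \<partial>M) = (if i = j then 1 else 0)"
begin

definition coef :: "('a \<Rightarrow> complex) \<Rightarrow> 'i \<Rightarrow> complex" where
  "coef g i = (\<integral>x. g x * cnj (e i x) \<partial>M)"

lemma coef_add:
  "square_integrable M f \<Longrightarrow> square_integrable M g \<Longrightarrow>
    coef (\<lambda>x. f x + g x) i = coef f i + coef g i"
  by (simp add: coef_def distrib_right integrable_mult_cnj square_integrable_family)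

lemma coef_diff:
  "square_integrable M f \<Longrightarrow> square_integrable M g \<Longrightarrow>
    coef (\<lambda>x. f x - g x) i = coef f i - coef g i"
  by (simp add: coef_def left_diff_distrib integrable_mult_cnj square_integrable_family)

lemma coef_cmult: "coef (\<lambda>x. c * f x) i = c * coef f i"
  by (simp add: coef_def mult.assoc)

lemma coef_sum:
  assumes "\<And>k. k \<in> F \<Longrightarrow> square_integrable M (f k)"
  shows "coef (\<lambda>x. \<Sum>k\<in>F. f k x) i = (\<Sum>k\<in>F. coef (f k) i)"
  using assms by (simp add: coef_def sum_distrib_right integrable_mult_cnj square_integrable_family)

lemma coef_cong_AE:
  assumes "f \<in> borel_measurable M" "g \<in> borel_measurable M" "AE x in M. f x = g x"
  shows "coef f i = coef g i"
  using assms square_integrable_measurable[OF square_integrable_family[of i]] unfolding coef_def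
  by (intro integral_cong_AE borel_measurable_times measurable_compose[OF _ borel_measurable_cnj]) auto

abbreviation partial_sum :: "('i \<Rightarrow> complex) \<Rightarrow> 'i set \<Rightarrow> 'a \<Rightarrow> complex" where
  "partial_sum c F \<equiv> \<lambda>x. \<Sum>i\<in>F. c i * e i x"

lemma square_integrable_partial_sum: "square_integrable M (partial_sum c F)"
  by (intro square_integrable_sum square_integrable_cmult square_integrable_family)

lemma coef_partial_sum:
  assumes "finite F" shows "coef (partial_sum c F) i = (if i \<in> F then c i else 0)"
proof -
  have "coef (e k) i = (if k = i then 1 else 0)" for k
    by (simp add: coef_def orthonormal)
  then have "coef (partial_sum c F) i = (\<Sum>k\<in>F. if k = i then c k else 0)"
    by (subst coef_sum) (auto simp: square_integrable_cmult square_integrable_family coef_cmult intro!: sum.cong)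
  then show ?thesis
    using assms by simp
qed

lemma integral_mult_cnj_partial_sum:
  assumes "square_integrable M g"
  shows "(\<integral>x. g x * cnj (partial_sum c F x) \<partial>M) = (\<Sum>i\<in>F. coef g i * cnj (c i))"
proof -
  have "g x * cnj (partial_sum c F x) = (\<Sum>i\<in>F. g x * cnj (e i x) * cnj (c i))" for x
    unfolding cnj_sum sum_distrib_left by (rule sum.cong) simp_all
  then have "(\<integral>x. g x * cnj (partial_sum c F x) \<partial>M) = (\<integral>x. (\<Sum>i\<in>F. g x * cnj (e i x) * cnj (c i)) \<partial>M)"
    by (simp only:)
  also have "\<dots> = (\<Sum>i\<in>F. coef g i * cnj (c i))"
    unfolding coef_def
    by (subst Bochner_Integration.integral_sum)
      (simp_all only: integrable_mult_left integral_mult_left_zero integrable_mult_cnj[OF assms square_integrable_family])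
  finally show ?thesis .
qed

lemma integral_partial_sum:
  assumes "finite F"
  shows "(\<integral>x. (cmod (partial_sum c F x))\<^sup>2 \<partial>M) = (\<Sum>i\<in>F. (cmod (c i))\<^sup>2)"
proof -
  have "complex_of_real (\<integral>x. (cmod (partial_sum c F x))\<^sup>2 \<partial>M) = of_real (\<Sum>i\<in>F. (cmod (c i))\<^sup>2)"
    unfolding integral_cmod_square_eq
    by (subst integral_mult_cnj_partial_sum[OF square_integrable_partial_sum])
       (simp add: complex_norm_square coef_partial_sum assms del: of_real_power)
  then show ?thesis
    unfolding of_real_eq_iff .
qed

text \<open>The cross term and the square norm of the partial sum both reduce to the sum of the
  \<open>(cmod (coef g i))\<^sup>2\<close>; subtracting it twice and adding it once leaves one copy.
  This is the Pythagorean theorem for the orthogonal projection onto the span of the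
  \<open>e i\<close> with \<open>i \<in> F\<close>.\<close>

lemma integral_diff_partial_sum:
  assumes g: "square_integrable M g" and F: "finite F"
  shows "(\<integral>x. (cmod (g x - partial_sum (coef g) F x))\<^sup>2 \<partial>M)
    = (\<integral>x. (cmod (g x))\<^sup>2 \<partial>M) - (\<Sum>i\<in>F. (cmod (coef g i))\<^sup>2)"
proof -
  have "(\<integral>x. g x * cnj (partial_sum (coef g) F x) \<partial>M) = of_real (\<Sum>i\<in>F. (cmod (coef g i))\<^sup>2)"
    unfolding integral_mult_cnj_partial_sum[OF g]
    by (simp add: complex_norm_square del: of_real_power)
  then show ?thesis
    unfolding integral_cmod_square_diff[OF g square_integrable_partial_sum] integral_partial_sum[OF F]
    by simp
qed

lemma bessel:
  assumes "square_integrable M g" "finite F"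
  shows "(\<Sum>i\<in>F. (cmod (coef g i))\<^sup>2) \<le> (\<integral>x. (cmod (g x))\<^sup>2 \<partial>M)"
proof -
  have "0 \<le> (\<integral>x. (cmod (g x - partial_sum (coef g) F x))\<^sup>2 \<partial>M)"
    by (rule Bochner_Integration.integral_nonneg) simp
  then show ?thesis
    unfolding integral_diff_partial_sum[OF assms] by simp
qed

lemma summable_coef:
  assumes "square_integrable M g"
  shows "(\<lambda>i. (cmod (coef g i))\<^sup>2) summable_on UNIV"
proof (rule nonneg_bounded_partial_sums_imp_summable_on)
  show "\<forall>\<^sub>F F in finite_subsets_at_top UNIV. (\<Sum>i\<in>F. (cmod (coef g i))\<^sup>2) \<le> (\<integral>x. (cmod (g x))\<^sup>2 \<partial>M)"
    by (rule eventually_finite_subsets_at_top_weakI) (rule bessel[OF assms])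
qed simp

text \<open>The defect in Bessel's inequality is the error of a partial sum, by
  \<open>integral_diff_partial_sum\<close>, so equality follows once some errors tend to 0. The rate
  \<open>(1/4) ^ k\<close> is the one at which \<open>riesz_fischer\<close> produces its partial
  sums.\<close>

lemma integral_eq_infsum_coef:
  assumes g: "square_integrable M g" and F: "\<And>k::nat. finite (F k)"
    and lim: "\<And>k. (\<integral>x. (cmod (g x - partial_sum (coef g) (F k) x))\<^sup>2 \<partial>M) \<le> (1/4) ^ k"
  shows "(\<integral>x. (cmod (g x))\<^sup>2 \<partial>M) = (\<Sum>\<^sub>\<infinity>i. (cmod (coef g i))\<^sup>2)"
proof (rule antisym)
  let ?s = "\<Sum>\<^sub>\<infinity>i. (cmod (coef g i))\<^sup>2"
  show "?s \<le> (\<integral>x. (cmod (g x))\<^sup>2 \<partial>M)"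
    by (rule infsum_le_finite_sums[OF summable_coef[OF g]]) (rule bessel[OF g])
  have "(\<integral>x. (cmod (g x))\<^sup>2 \<partial>M) \<le> ?s + (1/4) ^ k" for k
  proof -
    have "(\<Sum>i\<in>F k. (cmod (coef g i))\<^sup>2) \<le> ?s"
      by (rule finite_sum_le_infsum[OF summable_coef[OF g] F]) auto
    then show ?thesis
      using lim[of k] unfolding integral_diff_partial_sum[OF g F] by linarith
  qed
  moreover have "(\<lambda>k. ?s + (1/4) ^ k) \<longlonglongrightarrow> ?s + 0"
    by (intro tendsto_intros LIMSEQ_power_zero) auto
  ultimately show "(\<integral>x. (cmod (g x))\<^sup>2 \<partial>M) \<le> ?s"
    using LIMSEQ_le_const[of "\<lambda>k. ?s + (1/4) ^ k" "?s + 0"] by simp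
qed

text \<open>Pointwise convergence is extracted along partial sums whose consecutive \<open>L\<^sup>2\<close> distances are at
  most \<open>2 ^ - k\<close>; since \<open>2 t \<le> 2 ^ k * t\<^sup>2 + 2 ^ - k\<close>, these distances are summable in \<open>L\<^sup>1\<close>.\<close>

lemma riesz_fischer:
  assumes c: "(\<lambda>i. (cmod (c i))\<^sup>2) summable_on UNIV"
  obtains g where "square_integrable M g" "\<And>i. coef g i = c i"
    "(\<integral>x. (cmod (g x))\<^sup>2 \<partial>M) = (\<Sum>\<^sub>\<infinity>i. (cmod (c i))\<^sup>2)"
proof -
  let ?s = "\<Sum>\<^sub>\<infinity>i. (cmod (c i))\<^sup>2"
  have "\<exists>F. finite F \<and> ?s - (1/4) ^ k < (\<Sum>i\<in>F. (cmod (c i))\<^sup>2)" for k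
  proof -
    have "((\<lambda>F. \<Sum>i\<in>F. (cmod (c i))\<^sup>2) \<longlongrightarrow> ?s) (finite_subsets_at_top UNIV)"
      using has_sum_infsum[OF c] by (simp add: has_sum_def)
    then have "\<forall>\<^sub>F F in finite_subsets_at_top UNIV. ?s - (1/4) ^ k < (\<Sum>i\<in>F. (cmod (c i))\<^sup>2)"
      by (rule order_tendstoD) simp
    then show ?thesis
      by (auto simp: eventually_finite_subsets_at_top)
  qed
  then have "\<exists>F. \<forall>k::nat. finite (F k) \<and> ?s - (1/4) ^ k < (\<Sum>i\<in>F k. (cmod (c i))\<^sup>2)"
    by (intro choice allI)
  then obtain F where F: "\<And>k::nat. finite (F k)"
    "\<And>k. ?s - (1/4) ^ k < (\<Sum>i\<in>F k. (cmod (c i))\<^sup>2)"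
    by blast
  \<comment> \<open>The union makes the sets increase, so that the difference of two partial sums is
    again a partial sum, over indices outside \<open>G k\<close>, whose norm \<open>tail\<close>
    controls.\<close>
  define G where "G k = (\<Union>j\<le>k. F j)" for k
  have G: "finite (G k)" for k
    using F by (simp add: G_def)
  have G_mono: "G k \<subseteq> G l" if "k \<le> l" for k l
    using that by (force simp: G_def)
  have tail: "(\<Sum>i\<in>D. (cmod (c i))\<^sup>2) \<le> (1/4) ^ k" if "finite D" "D \<inter> G k = {}" for D k
  proof -
    have "(\<Sum>i\<in>F k. (cmod (c i))\<^sup>2) \<le> (\<Sum>i\<in>G k. (cmod (c i))\<^sup>2)"
      by (rule sum_mono2[OF G]) (auto simp: G_def)
    moreover have "(\<Sum>i\<in>G k \<union> D. (cmod (c i))\<^sup>2) = (\<Sum>i\<in>G k. (cmod (c i))\<^sup>2) + (\<Sum>i\<in>D. (cmod (c i))\<^sup>2)"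
      using that G by (intro sum.union_disjoint) auto
    moreover have "(\<Sum>i\<in>G k \<union> D. (cmod (c i))\<^sup>2) \<le> ?s"
      using that G by (intro finite_sum_le_infsum[OF c]) auto
    ultimately show ?thesis
      using F(2)[of k] by linarith
  qed
  define S where "S k = partial_sum c (G k)" for k
  have S[measurable]: "S k \<in> borel_measurable M" for k
    using square_integrable_partial_sum by (auto simp: S_def square_integrable_def)
  have diff: "S l x - S k x = partial_sum c (G l - G k) x" if "k \<le> l" for k l x
    using sum.subset_diff[OF G_mono[OF that] G, of "\<lambda>i. c i * e i x"] by (simp add: S_def)
  have dist: "(\<integral>x. (cmod (S l x - S k x))\<^sup>2 \<partial>M) \<le> (1/4) ^ k" if "k \<le> l" for k l
  proof -
    have "(\<integral>x. (cmod (S l x - S k x))\<^sup>2 \<partial>M) = (\<Sum>i\<in>G l - G k. (cmod (c i))\<^sup>2)"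
      unfolding diff[OF that] using G by (intro integral_partial_sum finite_Diff)
    also have "\<dots> \<le> (1/4) ^ k"
      using G by (intro tail finite_Diff) auto
    finally show ?thesis .
  qed
  have sqS: "square_integrable M (\<lambda>x. S l x - S k x)" for k l
    unfolding S_def by (intro square_integrable_diff square_integrable_partial_sum)
  have nn_dist: "(\<integral>\<^sup>+x. ennreal ((cmod (S l x - S k x))\<^sup>2) \<partial>M) \<le> ennreal ((1/4) ^ k)" if "k \<le> l" for k l
    unfolding nn_integral_eq_integral[OF square_integrableD[OF sqS] AE_I2[OF zero_le_power2]]
    by (intro ennreal_leI dist that)
  \<comment> \<open>In the constant, 1 comes from \<open>2 ^ k * (1/4) ^ k = (1/2) ^ k\<close>, and
    the measure of the space from integrating the constant \<open>(1/2) ^ k\<close>; here finiteness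
    of the measure enters.\<close>
  have step: "(\<integral>\<^sup>+x. ennreal (cmod (S (Suc k) x - S k x)) \<partial>M) \<le> ennreal ((1 + measure M (space M)) * (1/2) ^ k)" for k
  proof -
    let ?d = "\<lambda>x. cmod (S (Suc k) x - S k x)"
    have *: "t \<le> 2 ^ k * t\<^sup>2 + (1/2) ^ k" for t :: real
  proof -
      have "0 \<le> 2 ^ k * (t - (1/2)^k)\<^sup>2"
        by simp
      also have "\<dots> = 2 ^ k * t\<^sup>2 + (1/2)^k - 2 * t"
        by (simp add: power2_eq_square field_simps flip: power_mult_distrib)
      finally have **: "2 * t \<le> 2 ^ k * t\<^sup>2 + (1/2) ^ k"
        by simp
      show ?thesis
      proof (cases "t \<le> 0")
        case True
        have "0 \<le> 2 ^ k * t\<^sup>2 + (1/2) ^ k" by simp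
        with True show ?thesis by linarith
      qed (use ** in linarith)
    qed
    have int: "integrable M (\<lambda>x. 2 ^ k * (?d x)\<^sup>2 + (1/2) ^ k)"
      by (intro Bochner_Integration.integrable_add integrable_mult_right square_integrableD sqS) simp
    have "(\<integral>\<^sup>+x. ennreal (?d x) \<partial>M) \<le> (\<integral>\<^sup>+x. ennreal (2 ^ k * (?d x)\<^sup>2 + (1/2) ^ k) \<partial>M)"
      by (intro nn_integral_mono ennreal_leI *)
    also have "\<dots> = ennreal (\<integral>x. 2 ^ k * (?d x)\<^sup>2 + (1/2) ^ k \<partial>M)"
      by (rule nn_integral_eq_integral[OF int]) (rule AE_I2, simp)
    also have "(\<integral>x. 2 ^ k * (?d x)\<^sup>2 + (1/2) ^ k \<partial>M) = 2 ^ k * (\<integral>x. (?d x)\<^sup>2 \<partial>M) + (1/2) ^ k * measure M (space M)"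
      using square_integrableD[OF sqS] by (subst Bochner_Integration.integral_add) simp_all
    also have "2 ^ k * (\<integral>x. (?d x)\<^sup>2 \<partial>M) \<le> 2 ^ k * (1/4) ^ k"
      by (intro mult_left_mono dist) auto
    also have "2 ^ k * (1/4) ^ k = (1/2 :: real) ^ k"
      by (simp flip: power_mult_distrib)
    finally show ?thesis
      by (simp add: algebra_simps ennreal_leI)
  qed
  have conv: "AE x in M. convergent (\<lambda>k. S k x)"
  proof -
    have "(\<integral>\<^sup>+x. (\<Sum>k. ennreal (cmod (S (Suc k) x - S k x))) \<partial>M)
        = (\<Sum>k. \<integral>\<^sup>+x. ennreal (cmod (S (Suc k) x - S k x)) \<partial>M)"
      by (rule nn_integral_suminf) measurable
    also have "\<dots> \<le> (\<Sum>k. ennreal ((1 + measure M (space M)) * (1/2) ^ k))"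
      by (intro suminf_le step) auto
    also have "\<dots> < \<infinity>"
      by (subst suminf_ennreal2) (auto intro!: summable_mult summable_geometric)
    finally have "AE x in M. (\<Sum>k. ennreal (cmod (S (Suc k) x - S k x))) \<noteq> \<infinity>"
      by (intro nn_integral_PInf_AE) auto
    then show ?thesis
    proof (rule AE_mp, intro AE_I2 impI)
      fix x assume "(\<Sum>k. ennreal (cmod (S (Suc k) x - S k x))) \<noteq> \<infinity>"
      then have "summable (\<lambda>k. cmod (S (Suc k) x - S k x))"
        by (intro summable_suminf_not_top) auto
      then have "summable (\<lambda>k. S (Suc k) x - S k x)"
        by (rule summable_norm_cancel)
      then have "convergent (\<lambda>n. \<Sum>k<n. S (Suc k) x - S k x)"
        by (simp add: summable_iff_convergent)
      then have "convergent (\<lambda>n. S n x - S 0 x)"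
        using sum_lessThan_telescope[of "\<lambda>k. S k x"] by simp
      then show "convergent (\<lambda>k. S k x)"
        using convergent_add[OF _ convergent_const[of "S 0 x"]] by fastforce
    qed
  qed
  \<comment> \<open>\<open>lim\<close> is total, so \<open>g\<close> is measurable on the whole
    space; that it is the limit is known only almost everywhere, by \<open>conv\<close>.\<close>
  define g where "g x = lim (\<lambda>k. S k x)" for x
  have g[measurable]: "g \<in> borel_measurable M"
    unfolding g_def[abs_def] by measurable
  have g_lim: "AE x in M. (\<lambda>l. S l x) \<longlonglongrightarrow> g x"
    using conv by (auto simp: g_def convergent_LIMSEQ_iff)
  \<comment> \<open>Fatou's lemma carries the bound \<open>nn_dist\<close> for
    \<open>S l - S k\<close> over to the limit in \<open>l\<close>.\<close>
  have nn_g: "(\<integral>\<^sup>+x. ennreal ((cmod (g x - S k x))\<^sup>2) \<partial>M) \<le> ennreal ((1/4) ^ k)" for k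
  proof -
    have "AE x in M. ennreal ((cmod (g x - S k x))\<^sup>2) = liminf (\<lambda>l. ennreal ((cmod (S l x - S k x))\<^sup>2))"
      using g_lim
    proof (rule AE_mp, intro AE_I2 impI)
      fix x assume "(\<lambda>l. S l x) \<longlonglongrightarrow> g x"
      then have "(\<lambda>l. ennreal ((cmod (S l x - S k x))\<^sup>2)) \<longlonglongrightarrow> ennreal ((cmod (g x - S k x))\<^sup>2)"
        by (intro tendsto_intros tendsto_ennrealI)
      then show "ennreal ((cmod (g x - S k x))\<^sup>2) = liminf (\<lambda>l. ennreal ((cmod (S l x - S k x))\<^sup>2))"
        using lim_imp_Liminf[of sequentially] by (metis sequentially_bot)
    qed
    then have "(\<integral>\<^sup>+x. ennreal ((cmod (g x - S k x))\<^sup>2) \<partial>M)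
        = (\<integral>\<^sup>+x. liminf (\<lambda>l. ennreal ((cmod (S l x - S k x))\<^sup>2)) \<partial>M)"
      by (rule nn_integral_cong_AE)
    also have "\<dots> \<le> liminf (\<lambda>l. \<integral>\<^sup>+x. ennreal ((cmod (S l x - S k x))\<^sup>2) \<partial>M)"
      by (rule nn_integral_liminf) measurable
    also have "\<dots> \<le> ennreal ((1/4) ^ k)"
    proof (rule order_trans[OF Liminf_mono])
      show "\<forall>\<^sub>F l in sequentially. (\<integral>\<^sup>+x. ennreal ((cmod (S l x - S k x))\<^sup>2) \<partial>M) \<le> ennreal ((1/4) ^ k)"
        using eventually_ge_at_top[of k] by eventually_elim (rule nn_dist)
      show "liminf (\<lambda>l. ennreal ((1/4) ^ k)) \<le> ennreal ((1/4) ^ k)"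
        by (simp add: Liminf_const)
    qed
    finally show ?thesis .
  qed
  have sq_diff: "square_integrable M (\<lambda>x. g x - S k x)" for k
  proof -
    have gS: "(\<lambda>x. g x - S k x) \<in> borel_measurable M"
      by (intro borel_measurable_diff g S)
    moreover have "integrable M (\<lambda>x. (cmod (g x - S k x))\<^sup>2)"
    proof (rule integrableI_nonneg)
      show "(\<lambda>x. (cmod (g x - S k x))\<^sup>2) \<in> borel_measurable M"
        using gS by (intro borel_measurable_power borel_measurable_norm[THEN measurable_compose[rotated]])
      show "(\<integral>\<^sup>+x. ennreal ((cmod (g x - S k x))\<^sup>2) \<partial>M) < \<infinity>"
        using nn_g[of k] by (rule le_less_trans) simp
    qed simp
    ultimately show ?thesis
      unfolding square_integrable_def ..
  qed
  have sq_S: "square_integrable M (S k)" for k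
    unfolding S_def by (rule square_integrable_partial_sum)
  have sq: "square_integrable M g"
    using square_integrable_add[OF sq_diff[of 0] sq_S[of 0]] by simp
  have dist_g: "(\<integral>x. (cmod (g x - S k x))\<^sup>2 \<partial>M) \<le> (1/4) ^ k" for k
    using nn_g[of k]
    unfolding nn_integral_eq_integral[OF square_integrableD[OF sq_diff] AE_I2[OF zero_le_power2]] by simp
  have coef: "coef g i = c i" for i
  proof -
    \<comment> \<open>The error splits into the coefficient of \<open>g - S k\<close>, bounded by
      Bessel's inequality for the single index \<open>i\<close>, and
      \<open>coef (S k) i - c i\<close>, which is 0 if \<open>i \<in> G k\<close> and otherwise
      \<open>- c i\<close>, bounded by \<open>tail\<close> for \<open>{i}\<close>. Each is at most
      the square root of \<open>(1/4) ^ k\<close>.\<close>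
    have le: "cmod (coef g i - c i) \<le> 2 * (1/2) ^ k" for k
  proof -
      have "(cmod (coef (\<lambda>x. g x - S k x) i))\<^sup>2 \<le> (1/4) ^ k"
        using bessel[OF sq_diff[of k], of "{i}"] dist_g[of k] by simp
      also have "\<dots> = ((1/2) ^ k)\<^sup>2"
        by (simp add: power2_eq_square flip: power_mult_distrib)
      finally have 1: "cmod (coef (\<lambda>x. g x - S k x) i) \<le> (1/2) ^ k"
        by (rule power2_le_imp_le) simp
      have "(cmod (coef (S k) i - c i))\<^sup>2 \<le> (1/4) ^ k"
        using tail[of "{i}" k] by (auto simp: S_def coef_partial_sum G)
      also have "\<dots> = ((1/2) ^ k)\<^sup>2"
        by (simp add: power2_eq_square flip: power_mult_distrib)
      finally have 2: "cmod (coef (S k) i - c i) \<le> (1/2) ^ k"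
        by (rule power2_le_imp_le) simp
      have "coef g i - c i = coef (\<lambda>x. g x - S k x) i + (coef (S k) i - c i)"
        by (simp add: coef_diff sq sq_S)
      then show ?thesis
        using norm_triangle_mono[OF 1 2] by (simp only: mult_2)
    qed
    have "(\<lambda>k. 2 * (1/2) ^ k) \<longlonglongrightarrow> 2 * (0 :: real)"
      by (intro tendsto_intros LIMSEQ_power_zero) auto
    then have "cmod (coef g i - c i) \<le> 2 * 0"
      by (rule LIMSEQ_le_const) (use le in blast)
    then show ?thesis
      by simp
  qed
  have "coef g = c"
    using coef by blast
  have "(\<integral>x. (cmod (g x))\<^sup>2 \<partial>M) = ?s"
    using integral_eq_infsum_coef[OF sq, of G] G dist_g
    unfolding S_def \<open>coef g = c\<close> by blast
  with sq coef show ?thesis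
    using that by blast
qed

end

section \<open>Completeness and Parseval's identity\<close>

locale complete_orthonormal_family = orthonormal_family +
  assumes complete: "square_integrable M h \<Longrightarrow> (\<And>i. coef h i = 0) \<Longrightarrow> AE x in M. h x = 0"
begin

lemma AE_eq_if_coef_eq:
  assumes "square_integrable M f" "square_integrable M g" "\<And>i. coef f i = coef g i"
  shows "AE x in M. f x = g x"
  using complete[OF square_integrable_diff[OF assms(1,2)]] by (simp add: coef_diff assms)

text \<open>Completeness is assumed as triviality of the orthogonal complement. To reach the
  identity, Riesz-Fischer builds a function with the coefficients of \<open>g\<close> and with
  exactly the norm required, and completeness identifies it with \<open>g\<close> almost
  everywhere.\<close>

lemma parseval:
  assumes g: "square_integrable M g"
  shows "((\<lambda>i. (cmod (coef g i))\<^sup>2) has_sum (\<integral>x. (cmod (g x))\<^sup>2 \<partial>M)) UNIV"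
proof -
  obtain g' where g': "square_integrable M g'" "\<And>i. coef g' i = coef g i"
    "(\<integral>x. (cmod (g' x))\<^sup>2 \<partial>M) = (\<Sum>\<^sub>\<infinity>i. (cmod (coef g i))\<^sup>2)"
    using riesz_fischer[OF summable_coef[OF g]] by metis
  have "AE x in M. (cmod (g' x))\<^sup>2 = (cmod (g x))\<^sup>2"
    using AE_eq_if_coef_eq[OF g'(1) g g'(2)] by eventually_elim simp
  then have "(\<integral>x. (cmod (g' x))\<^sup>2 \<partial>M) = (\<integral>x. (cmod (g x))\<^sup>2 \<partial>M)"
    using g g'(1) by (intro integral_cong_AE) (auto simp: square_integrable_def dest: borel_measurable_integrable)
  then show ?thesis
    using has_sum_infsum[OF summable_coef[OF g]] g'(3) by simp
qed

text \<open>By polarization, from the norm identity for \<open>f + c * g\<close> with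
  \<open>c\<close> among \<open>1\<close>, \<open>-1\<close>, \<open>\<i>\<close> and
  \<open>- \<i>\<close>.\<close>

lemma parseval_inner:
  assumes f: "square_integrable M f" and g: "square_integrable M g"
  shows "((\<lambda>i. coef f i * cnj (coef g i)) has_sum (\<integral>x. f x * cnj (g x) \<partial>M)) UNIV"
proof -
  \<comment> \<open>The factors \<open>1 *\<close> and \<open>(-1) *\<close> are kept so that all
    four terms are instances of one pattern in \<open>c\<close>, to which \<open>N\<close> and
    \<open>sums\<close> apply.\<close>
  have polar: "x * cnj y = (of_real ((cmod (x + 1 * y))\<^sup>2) + (-1) * of_real ((cmod (x + (-1) * y))\<^sup>2)
      + \<i> * of_real ((cmod (x + \<i> * y))\<^sup>2) + (- \<i>) * of_real ((cmod (x + (- \<i>) * y))\<^sup>2)) / 4" for x y :: complex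
    unfolding cmod_power2 by (simp add: complex_eq_iff power2_eq_square algebra_simps)
  have sq: "square_integrable M (\<lambda>x. f x + c * g x)" for c
    by (intro square_integrable_add square_integrable_cmult f g)
  define N where "N c = complex_of_real (\<integral>x. (cmod (f x + c * g x))\<^sup>2 \<partial>M)" for c
  have "coef (\<lambda>x. f x + c * g x) i = coef f i + c * coef g i" for c i
    by (simp add: coef_add f g square_integrable_cmult coef_cmult)
  then have sums: "((\<lambda>i. complex_of_real ((cmod (coef f i + c * coef g i))\<^sup>2)) has_sum N c) UNIV" for c
    using has_sum_of_real[OF parseval[OF sq[of c]]] by (simp add: N_def)
  have int: "integrable M (\<lambda>x. complex_of_real ((cmod (f x + c * g x))\<^sup>2))" for c
    using square_integrableD[OF sq[of c]] by (rule integrable_of_real)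
  have N: "(\<integral>x. complex_of_real ((cmod (f x + c * g x))\<^sup>2) \<partial>M) = N c" for c
    unfolding N_def by (rule integral_complex_of_real)
  have "(\<integral>x. f x * cnj (g x) \<partial>M) = (N 1 + (-1) * N (-1) + \<i> * N \<i> + (- \<i>) * N (- \<i>)) / 4"
    unfolding polar
    by (simp only: integral_divide_zero Bochner_Integration.integral_add
        integral_mult_right_zero Bochner_Integration.integrable_add
        integrable_mult_right int N)
  moreover have "((\<lambda>i. coef f i * cnj (coef g i)) has_sum (N 1 + (-1) * N (-1) + \<i> * N \<i> + (- \<i>) * N (- \<i>)) / 4) UNIV"
    unfolding polar divide_inverse
    by (intro has_sum_cmult_left has_sum_add has_sum_cmult_right sums)
  ultimately show ?thesis by (simp only:)
qed

text \<open>A choice, because the coefficients determine the function only almost everywhere; it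
  carries information only for square summable \<open>c\<close>.\<close>

definition synthesis :: "('b \<Rightarrow> complex) \<Rightarrow> 'a \<Rightarrow> complex" where
  "synthesis c = (SOME g. square_integrable M g \<and> coef g = c)"

lemma
  assumes "(\<lambda>i. (cmod (c i))\<^sup>2) summable_on UNIV"
  shows square_integrable_synthesis: "square_integrable M (synthesis c)"
    and coef_synthesis: "coef (synthesis c) = c"
proof -
  obtain g where "square_integrable M g \<and> coef g = c"
    using riesz_fischer[OF assms] by (metis ext)
  then have "square_integrable M (synthesis c) \<and> coef (synthesis c) = c"
    unfolding synthesis_def by (rule someI[of "\<lambda>g. square_integrable M g \<and> coef g = c"])
  then show "square_integrable M (synthesis c)" "coef (synthesis c) = c"
    by auto
qed

end

lemma (in finite_measure) integrable_if_square_integrable: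
  assumes "square_integrable M f" shows "integrable M f"
proof -
  have "square_integrable M (\<lambda>_. 1)"
    by (simp add: square_integrable_def)
  from integrable_mult_cnj[OF assms this] show ?thesis by simp
qed

section \<open>Fourier series on the torus\<close>

definition character :: "int^'d \<Rightarrow> real^'d \<Rightarrow> complex" where
  "character m \<theta> = exp (\<i> * complex_of_real ((\<chi> s. real_of_int (m $ s)) \<bullet> \<theta>))"

lemma character_eq_cis: "character m \<theta> = cis ((\<chi> s. real_of_int (m $ s)) \<bullet> \<theta>)"
  by (simp add: character_def cis_conv_exp)

lemma character_0[simp]: "character 0 \<theta> = 1"
  by (simp add: character_def inner_vec_def)

lemma character_add: "character (m + n) \<theta> = character m \<theta> * character n \<theta>"
  by (simp add: character_eq_cis cis_mult inner_vec_def distrib_right sum.distrib)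

lemma cnj_character: "cnj (character m \<theta>) = character (- m) \<theta>"
  by (simp add: character_eq_cis cis_cnj inner_vec_def sum_negf)

lemma norm_character[simp]: "cmod (character m \<theta>) = 1"
  by (simp add: character_eq_cis)

lemma character_prod: "character m \<theta> = (\<Prod>s\<in>UNIV. cis (real_of_int (m $ s) * \<theta> $ s))"
proof -
  have "cis (\<Sum>s\<in>S. f s) = (\<Prod>s\<in>S. cis (f s))" if "finite S" for S :: "'a set" and f
    using that by induction (auto simp flip: cis_mult)
  then show ?thesis
    by (simp add: character_eq_cis inner_vec_def)
qed

lemma continuous_on_character: "continuous_on S (character m)"
  unfolding character_def by (intro continuous_intros)

lemma borel_measurable_character[measurable]: "character m \<in> borel_measurable borel"
  by (intro borel_measurable_continuous_onI continuous_on_character)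

section \<open>Integration over the torus and orthonormality of the characters\<close>

lemma sets_torus[measurable]: "torus \<in> sets borel"
  unfolding torus_def by measurable

lemma space_torus_measure[simp]: "space (torus_measure :: (real^'d) measure) = torus"
  by (simp add: torus_measure_def space_restrict_space)

lemma sets_torus_measure: "sets (torus_measure :: (real^'d) measure) = sets (restrict_space borel torus)"
  unfolding torus_measure_def by (simp add: sets_restrict_space)

lemma measurable_torus_measure:
  "f \<in> measurable borel N \<Longrightarrow> f \<in> measurable (torus_measure :: (real^'d) measure) N"
  using measurable_restrict_space1 by (subst measurable_cong_sets[OF sets_torus_measure refl]) auto

lemma integral_torus_measure:
  fixes f :: "real^'d \<Rightarrow> complex"
  assumes f: "f \<in> borel_measurable borel"
  shows "(\<integral>\<theta>. f \<theta> \<partial>torus_measure) = (\<integral>\<theta>. indicator torus \<theta> *\<^sub>R f \<theta> \<partial>lborel) /\<^sub>R (2 * pi) ^ CARD('d)"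
proof -
  have [measurable]: "f \<in> borel_measurable (restrict_space lborel torus)"
    using f by (intro measurable_restrict_space1) simp
  have "(\<integral>\<theta>. f \<theta> \<partial>torus_measure)
      = (\<integral>\<theta>. (1 / (2 * pi) ^ CARD('d)) *\<^sub>R f \<theta> \<partial>restrict_space lborel torus)"
    unfolding torus_measure_def by (rule integral_density) auto
  also have "\<dots> = (1 / (2 * pi) ^ CARD('d)) *\<^sub>R (\<integral>\<theta>. f \<theta> \<partial>restrict_space lborel torus)"
    by (rule integral_scaleR_right)
  also have "(\<integral>\<theta>. f \<theta> \<partial>restrict_space lborel torus) = (\<integral>\<theta>. indicator torus \<theta> *\<^sub>R f \<theta> \<partial>lborel)"
    by (rule integral_restrict_space) (simp add: sets_torus)
  finally show ?thesis
    by (simp add: field_simps)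
qed

lemma finite_measure_torus: "finite_measure (torus_measure :: (real^'d) measure)"
proof (rule finite_measureI)
  have "(torus :: (real^'d) set) \<subseteq> cbox 0 (\<chi> s. 2 * pi)"
    by (auto simp: torus_def mem_box_cart less_imp_le)
  then have "emeasure lborel (torus :: (real^'d) set) < \<infinity>"
    by (rule le_less_trans[OF emeasure_mono]) (auto simp: emeasure_lborel_cbox_eq)
  moreover have "emeasure (torus_measure :: (real^'d) measure) torus
      = ennreal (1 / (2 * pi) ^ CARD('d)) * emeasure (restrict_space lborel torus) (torus :: (real^'d) set)"
    unfolding torus_measure_def by (subst emeasure_density_const) (auto simp: sets_restrict_space sets_torus)
  moreover have "emeasure (restrict_space lborel (torus :: (real^'d) set)) torus = emeasure lborel (torus :: (real^'d) set)"
    by (intro emeasure_restrict_space) (auto simp: sets_torus)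
  ultimately show "emeasure (torus_measure :: (real^'d) measure) (space torus_measure) \<noteq> \<infinity>"
    by (simp add: ennreal_mult_eq_top_iff)
qed

text \<open>Fubini's theorem for a product of functions of single coordinates. Lebesgue measure on
  \<open>real^'d\<close> is the image of the product measure indexed by \<open>Basis\<close>, so the
  work lies in passing from indices \<open>s\<close> to basis vectors
  \<open>axis s 1\<close>.\<close>

lemma lborel_integral_prod:
  fixes f :: "'d::finite \<Rightarrow> real \<Rightarrow> complex"
  assumes f: "\<And>s. integrable lborel (f s)"
  shows "(\<integral>x. (\<Prod>s\<in>UNIV. f s (x $ s)) \<partial>lborel) = (\<Prod>s\<in>UNIV. integral\<^sup>L lborel (f s))"
proof -
  interpret product_sigma_finite "\<lambda>_ :: real^'d. lborel :: real measure" ..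
  have inj: "inj (\<lambda>s :: 'd. axis s (1::real))"
    by (auto simp: inj_on_def axis_eq_axis)
  have Basis: "(Basis :: (real^'d) set) = range (\<lambda>s. axis s 1)"
    by (auto simp: Basis_vec_def)
  have [measurable]: "f s \<in> borel_measurable borel" for s
    using f[of s] by (auto dest: borel_measurable_integrable)
  let ?T = "\<lambda>x. \<Sum>b\<in>Basis. x b *\<^sub>R (b :: real^'d)"
  have T: "?T x $ s = x (axis s 1)" for x s
  proof -
    have "?T x $ s = (\<Sum>b\<in>Basis. x b * (b $ s))"
      by simp
    also have "\<dots> = (\<Sum>t\<in>UNIV. x (axis t 1) * (axis t 1 $ s))"
      unfolding Basis by (subst sum.reindex[OF inj]) simp
    also have "\<dots> = (\<Sum>t\<in>UNIV. if t = s then x (axis t 1) else 0)"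
      by (rule sum.cong) (auto simp: axis_def)
    finally show ?thesis by simp
  qed
  define g where "g b = f (inv (\<lambda>s. axis s 1) b)" for b :: "real^'d"
  have g: "g (axis s 1) = f s" for s
    unfolding g_def using inv_f_f[OF inj, of s] by simp
  have "(\<integral>x. (\<Prod>s\<in>UNIV. f s (x $ s)) \<partial>lborel)
      = (\<integral>x. (\<Prod>s\<in>UNIV. f s (?T x $ s)) \<partial>(\<Pi>\<^sub>M b\<in>(Basis :: (real^'d) set). lborel))"
    by (subst lborel_eq, rule integral_distr) measurable
  also have "\<dots> = (\<integral>x. (\<Prod>s\<in>UNIV. f s (x (axis s 1))) \<partial>(\<Pi>\<^sub>M b\<in>(Basis :: (real^'d) set). lborel))"
    by (simp only: T)
  also have "\<dots> = (\<integral>x. (\<Prod>b\<in>Basis. g b (x b)) \<partial>(\<Pi>\<^sub>M b\<in>(Basis :: (real^'d) set). lborel))"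
    unfolding Basis by (subst prod.reindex[OF inj]) (simp add: g)
  also have "\<dots> = (\<Prod>b\<in>(Basis :: (real^'d) set). integral\<^sup>L lborel (g b))"
    by (rule product_integral_prod) (auto simp: g_def f)
  also have "\<dots> = (\<Prod>s\<in>UNIV. integral\<^sup>L lborel (f s))"
    unfolding Basis by (subst prod.reindex[OF inj]) (simp add: g)
  finally show ?thesis .
qed

lemma integral_cis_period:
  fixes m :: int
  shows "integrable lborel (\<lambda>t. indicator {0..<2*pi} t *\<^sub>R cis (real_of_int m * t))"
    and "(\<integral>t. indicator {0..<2*pi} t *\<^sub>R cis (real_of_int m * t) \<partial>lborel) = (if m = 0 then 2 * pi else 0)"
proof -
  have cont: "continuous_on {0..2*pi} (\<lambda>t. cis (real_of_int m * t))"
    unfolding cis_conv_exp by (intro continuous_intros)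
  have int: "integrable lborel (\<lambda>t. indicator {0..2*pi} t *\<^sub>R cis (real_of_int m * t))"
    using borel_integrable_atLeastAtMost'[OF cont] by (simp add: set_integrable_def)
  \<comment> \<open>The torus is built from the half-open interval, while the fundamental theorem of
    calculus needs the closed one; they differ in the null set \<open>{2 * pi}\<close>.\<close>
  have ae: "AE t in lborel. indicator {0..<2*pi} t *\<^sub>R cis (real_of_int m * t)
      = indicator {0..2*pi} t *\<^sub>R cis (real_of_int m * t)"
    using AE_lborel_singleton[of "2 * pi"] by eventually_elim (auto simp: indicator_def)
  have meas: "(\<lambda>t. cis (real_of_int m * t)) \<in> borel_measurable borel"
    unfolding cis_conv_exp by (intro borel_measurable_continuous_onI continuous_intros)
  show "integrable lborel (\<lambda>t. indicator {0..<2*pi} t *\<^sub>R cis (real_of_int m * t))"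
    using int by (rule Bochner_Integration.integrable_bound) (use meas in \<open>auto simp: indicator_def\<close>)
  have "(\<integral>t. indicator {0..<2*pi} t *\<^sub>R cis (real_of_int m * t) \<partial>lborel)
      = (\<integral>t. indicator {0..2*pi} t *\<^sub>R cis (real_of_int m * t) \<partial>lborel)"
    using ae meas by (intro integral_cong_AE) auto
  also have "\<dots> = (if m = 0 then 2 * pi else 0)"
  proof (cases "m = 0")
    case True
    then show ?thesis by (simp add: scaleR_conv_of_real)
  next
    case False
    let ?F = "\<lambda>t :: real. cis (real_of_int m * t) / (\<i> * of_int m)"
    have "(?F has_vector_derivative cis (real_of_int m * t)) (at t within {0..2*pi})" for t
    proof -
      have "((\<lambda>z. exp (\<i> * (of_int m * z)) / (\<i> * of_int m)) has_field_derivative exp (\<i> * (of_int m * of_real t)))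
          (at (of_real t))"
        using False by (auto intro!: derivative_eq_intros simp: algebra_simps)
      from has_vector_derivative_real_field[OF this] show ?thesis
        by (simp add: cis_conv_exp)
    qed
    then have "(\<integral>t. indicator {0..2*pi} t *\<^sub>R cis (real_of_int m * t) \<partial>lborel) = ?F (2*pi) - ?F 0"
      using cont by (intro integral_FTC_Icc) auto
    also have "cis (real_of_int m * (2 * pi)) = 1"
      by (metis cis_multiple_2pi Ints_of_int mult.commute)
    finally show ?thesis using False by simp
  qed
  finally show "(\<integral>t. indicator {0..<2*pi} t *\<^sub>R cis (real_of_int m * t) \<partial>lborel) = (if m = 0 then 2 * pi else 0)" .
qed

lemma integral_character:
  "(\<integral>\<theta>. character m \<theta> \<partial>torus_measure) = (if m = 0 then 1 else 0)" for m :: "int^'d"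
proof -
  have ind: "indicator torus \<theta> *\<^sub>R character m \<theta>
      = (\<Prod>s\<in>UNIV. indicator {0..<2*pi} (\<theta> $ s) *\<^sub>R cis (real_of_int (m $ s) * \<theta> $ s))" for \<theta>
  proof (cases "\<theta> \<in> torus")
    case True
    then have "indicator {0..<2*pi} (\<theta> $ s) = (1::real)" for s
      by (simp add: torus_def)
    then show ?thesis
      using True by (simp add: character_prod)
  next
    case False
    then obtain s where "\<theta> $ s \<notin> {0..<2*pi}"
      by (auto simp: torus_def)
    then have "indicator {0..<2*pi} (\<theta> $ s) *\<^sub>R cis (real_of_int (m $ s) * \<theta> $ s) = 0"
      by (simp add: indicator_def)
    then have "(\<Prod>s\<in>UNIV. indicator {0..<2*pi} (\<theta> $ s) *\<^sub>R cis (real_of_int (m $ s) * \<theta> $ s)) = 0"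
      by (intro prod_zero) auto
    then show ?thesis
      using False by simp
  qed
  have "(\<integral>\<theta>. character m \<theta> \<partial>torus_measure)
      = (\<Prod>s\<in>UNIV. if m $ s = 0 then complex_of_real (2 * pi) else 0) /\<^sub>R (2 * pi) ^ CARD('d)"
    unfolding integral_torus_measure[OF borel_measurable_character] ind
    by (subst lborel_integral_prod)
      (simp_all add: integral_cis_period if_distrib[of complex_of_real] cong: if_cong)
  also have "\<dots> = (if m = 0 then 1 else 0)"
  proof (cases "m = 0")
    case True
    have "complex_of_real c /\<^sub>R c = 1" if "c \<noteq> 0" for c
      using that by (simp add: scaleR_conv_of_real)
    from this[of "(2 * pi) ^ CARD('d)"] show ?thesis
      using True by (simp only: zero_index if_True prod_constant of_real_power) simp
  next
    case False
    then obtain s where "m $ s \<noteq> 0" by (auto simp: vec_eq_iff)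
    then have "(\<Prod>s\<in>UNIV. if m $ s = 0 then complex_of_real (2 * pi) else 0) = 0"
      by (intro prod_zero) auto
    then show ?thesis using False by simp
  qed
  finally show ?thesis .
qed

text \<open>With the minus sign, \<open>coef g m\<close> is the integral of \<open>g\<close> against
  \<open>character m\<close>, that is the coefficient of
  \<open>exp (- \<i> * \<langle>m, \<theta>\<rangle>)\<close>, as in the Floquet transform.
  Multiplication by \<open>character n\<close> then moves the coefficient at \<open>m + n\<close> to
  \<open>m\<close>.\<close>

lemma orthonormal_characters:
  "orthonormal_family torus_measure (\<lambda>m :: int^'d. character (- m))"
proof -
  interpret finite_measure "torus_measure :: (real^'d) measure"
    by (rule finite_measure_torus)
  have "square_integrable torus_measure (character m)" for m :: "int^'d"
    by (simp add: square_integrable_def measurable_torus_measure)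
  moreover have "(\<integral>\<theta>. character (- m) \<theta> * cnj (character (- n) \<theta>) \<partial>torus_measure) = (if m = n then 1 else 0)" for m n :: "int^'d"
    unfolding cnj_character character_add[symmetric] integral_character by simp
  ultimately show ?thesis
    by unfold_locales
qed

section \<open>Trigonometric polynomials and completeness of the characters\<close>

inductive trig_poly :: "(real^'d \<Rightarrow> complex) \<Rightarrow> bool" where
  trig_poly_character: "trig_poly (character m)"
| trig_poly_add: "trig_poly f \<Longrightarrow> trig_poly g \<Longrightarrow> trig_poly (\<lambda>\<theta>. f \<theta> + g \<theta>)"
| trig_poly_cmult: "trig_poly f \<Longrightarrow> trig_poly (\<lambda>\<theta>. c * f \<theta>)"

lemma trig_poly_const: "trig_poly (\<lambda>\<theta>. c)"
  using trig_poly_cmult[OF trig_poly_character[of 0], of c] by simp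

lemma trig_poly_sum:
  "(\<And>i. i \<in> F \<Longrightarrow> trig_poly (f i)) \<Longrightarrow> trig_poly (\<lambda>\<theta>. \<Sum>i\<in>F. f i \<theta>)"
  by (induction F rule: infinite_finite_induct) (auto intro: trig_poly_const trig_poly_add)

text \<open>Characters are closed under products, so their span is an algebra. Two nested inductions
  over the generation of \<open>trig_poly\<close> replace the multiplication of explicit finite
  sums.\<close>

lemma trig_poly_mult:
  assumes "trig_poly f" "trig_poly g" shows "trig_poly (\<lambda>\<theta>. f \<theta> * g \<theta>)"
  using assms(1)
proof induction
  case (trig_poly_character m)
  show ?case
    using assms(2)
  proof induction
    case (trig_poly_character n)
    have "(\<lambda>\<theta>. character m \<theta> * character n \<theta>) = character (m + n)"
      by (simp add: character_add fun_eq_iff)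
    then show ?case
      by (simp add: trig_poly.trig_poly_character)
  next
    case (trig_poly_add f g)
    show ?case
      unfolding distrib_left by (rule trig_poly.trig_poly_add[OF trig_poly_add.IH])
  next
    case (trig_poly_cmult f c)
    have "(\<lambda>\<theta>. character m \<theta> * (c * f \<theta>)) = (\<lambda>\<theta>. c * (character m \<theta> * f \<theta>))"
      by (simp add: fun_eq_iff)
    then show ?case
      using trig_poly.trig_poly_cmult[OF trig_poly_cmult.IH, of c] by (simp only:)
  qed
next
  case (trig_poly_add f g)
  show ?case
    unfolding distrib_right by (rule trig_poly.trig_poly_add[OF trig_poly_add.IH])
next
  case (trig_poly_cmult f c)
  show ?case
    unfolding mult.assoc by (rule trig_poly.trig_poly_cmult[OF trig_poly_cmult.IH])
qed

text \<open>On the half-open cube this is injective, with image in the compact set of vectors whose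
  components have modulus 1. Stone-Weierstrass is applied on that set, in the real coordinates of
  the ambient space \<open>complex^'d\<close>.\<close>

definition torus_embedding :: "real^'d \<Rightarrow> complex^'d" where
  "torus_embedding \<theta> = (\<chi> s. cis (\<theta> $ s))"

lemma continuous_on_torus_embedding: "continuous_on S torus_embedding"
  unfolding torus_embedding_def cis_conv_exp by (intro continuous_intros continuous_on_component)

lemma borel_measurable_torus_embedding[measurable]: "torus_embedding \<in> borel_measurable borel"
  by (intro borel_measurable_continuous_onI continuous_on_torus_embedding)

lemma compact_torus_image: "compact {z :: complex^'d. \<forall>s. cmod (z $ s) = 1}"
proof -
  have "closed {z :: complex^'d. \<forall>s. cmod (z $ s) = 1}"
    by (intro closed_Collect_all closed_Collect_eq continuous_intros)
  moreover have "norm z \<le> real CARD('d)" if "\<forall>s. cmod (z $ s) = 1" for z :: "complex^'d"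
    using that L2_set_le_sum[of UNIV "\<lambda>s. cmod (z $ s)"] by (simp add: norm_vec_def)
  then have "{z :: complex^'d. \<forall>s. cmod (z $ s) = 1} \<subseteq> cball 0 (real CARD('d))"
    by auto
  ultimately show ?thesis
    by (meson bounded_cball bounded_subset compact_eq_bounded_closed)
qed

text \<open>A basis vector of \<open>complex^'d\<close> is \<open>axis s 1\<close> or
  \<open>axis s \<i>\<close>, so the real coordinates of the embedding are cosines and sines of
  single angles, and Euler's formulas express these by \<open>character (axis s 1)\<close> and
  \<open>character (- axis s 1)\<close>.\<close>

lemma trig_poly_coordinate:
  fixes b :: "complex^'d"
  assumes "b \<in> Basis"
  shows "trig_poly (\<lambda>\<theta> :: real^'d. complex_of_real (torus_embedding \<theta> \<bullet> b))"
proof -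
  obtain s u where b: "b = axis s u" and u: "u \<in> {1, \<i>}"
    using assms by (auto simp: Basis_vec_def Basis_complex_def)
  have *: "cis (\<theta> $ s) = character (axis s 1) \<theta>" "cis (- (\<theta> $ s)) = character (- axis s 1) \<theta>" for \<theta> :: "real^'d"
  proof -
    have "(\<chi> t. real_of_int (axis s 1 $ t)) = axis s 1"
      by (simp add: vec_eq_iff axis_def)
    then have **: "character (axis s 1) \<theta> = cis (\<theta> $ s)"
      by (simp add: character_eq_cis inner_axis' )
    then show "cis (\<theta> $ s) = character (axis s 1) \<theta>" ..
    show "cis (- (\<theta> $ s)) = character (- axis s 1) \<theta>"
      unfolding cnj_character[symmetric] ** by (simp add: cis_cnj)
  qed
  have "complex_of_real (cos t) = (1/2) * cis t + (1/2) * cis (- t)"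
    "complex_of_real (sin t) = (- \<i>/2) * cis t + (\<i>/2) * cis (- t)" for t
    by (auto simp: complex_eq_iff)
  then have "complex_of_real (cos (\<theta> $ s)) = (1/2) * character (axis s 1) \<theta> + (1/2) * character (- axis s 1) \<theta>"
    "complex_of_real (sin (\<theta> $ s)) = (- \<i>/2) * character (axis s 1) \<theta> + (\<i>/2) * character (- axis s 1) \<theta>"
    for \<theta> :: "real^'d"
    by (simp_all only: *[symmetric])
  moreover have "trig_poly (\<lambda>\<theta>. c * character (axis s 1) \<theta> + c' * character (- axis s 1) \<theta>)" for c c'
    by (intro trig_poly_add trig_poly_cmult trig_poly_character)
  ultimately have "trig_poly (\<lambda>\<theta>. complex_of_real (cos (\<theta> $ s)))" "trig_poly (\<lambda>\<theta>. complex_of_real (sin (\<theta> $ s)))"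
    by (simp_all only:)
  moreover have "complex_of_real (torus_embedding \<theta> \<bullet> b)
      = (if u = 1 then complex_of_real (cos (\<theta> $ s)) else complex_of_real (sin (\<theta> $ s)))" for \<theta> :: "real^'d"
    using u by (auto simp: b torus_embedding_def inner_axis inner_complex_def)
  ultimately show ?thesis
    by (cases "u = 1") simp_all
qed

text \<open>The link between two notions of polynomial: Stone-Weierstrass yields real polynomials in
  the coordinates of \<open>complex^'d\<close>, whereas orthogonality is known for
  characters.\<close>

lemma trig_poly_real_polynomial:
  fixes p :: "complex^'d \<Rightarrow> real"
  assumes "real_polynomial_function p"
  shows "trig_poly (\<lambda>\<theta>. complex_of_real (p (torus_embedding \<theta>)))"
  using assms
proof induction
  case (linear f)
  then have "linear f"
    by (simp add: bounded_linear.linear)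
  have rep: "complex_of_real (f z) = (\<Sum>b\<in>Basis. complex_of_real (f b) * complex_of_real (z \<bullet> b))" for z
  proof -
    have "f (\<Sum>b\<in>Basis. (z \<bullet> b) *\<^sub>R b) = (\<Sum>b\<in>Basis. f b * (z \<bullet> b))"
      by (simp add: linear_sum[OF \<open>linear f\<close>] linear_cmul[OF \<open>linear f\<close>] mult.commute)
    then show ?thesis
      by (simp add: euclidean_representation)
  qed
  have "trig_poly (\<lambda>\<theta>. \<Sum>b\<in>Basis. complex_of_real (f b) * complex_of_real (torus_embedding \<theta> \<bullet> b))"
    by (rule trig_poly_sum) (rule trig_poly_cmult, rule trig_poly_coordinate)
  then show ?case
    unfolding rep[symmetric] .
next
  case (const c)
  show ?case by (rule trig_poly_const)
next
  case (add f g)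
  show ?case unfolding of_real_add by (rule trig_poly_add[OF add.IH])
next
  case (mult f g)
  show ?case unfolding of_real_mult by (rule trig_poly_mult[OF mult.IH])
qed

text \<open>By Stone--Weierstrass, \<open>h\<close> is orthogonal to all continuous functions of \<open>torus_embedding\<close>; the sets
  over which it integrates to 0 then form a Dynkin system that contains all closed sets.\<close>

context
  fixes h :: "real^'d \<Rightarrow> complex"
  assumes h: "integrable torus_measure h"
    and orth: "\<And>m. (\<integral>\<theta>. h \<theta> * character m \<theta> \<partial>torus_measure) = 0"
begin

lemma integrable_mult_bounded:
  assumes "f \<in> borel_measurable torus_measure" "\<And>\<theta>. cmod (f \<theta>) \<le> C"
  shows "integrable torus_measure (\<lambda>\<theta>. h \<theta> * f \<theta>)"
proof (rule Bochner_Integration.integrable_bound)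
  show "integrable torus_measure (\<lambda>\<theta>. C * cmod (h \<theta>))"
    using h by simp
  show "(\<lambda>\<theta>. h \<theta> * f \<theta>) \<in> borel_measurable torus_measure"
    using assms h by (intro borel_measurable_times) (auto dest: borel_measurable_integrable)
  have "cmod (h \<theta>) * cmod (f \<theta>) \<le> \<bar>C\<bar> * cmod (h \<theta>)" for \<theta>
    using mult_right_mono[OF order_trans[OF assms(2) abs_ge_self], of "cmod (h \<theta>)"] by (simp add: mult.commute)
  then show "AE \<theta> in torus_measure. norm (h \<theta> * f \<theta>) \<le> norm (C * cmod (h \<theta>))"
    by (simp add: norm_mult abs_mult)
qed

lemma integral_trig_poly:
  assumes "trig_poly f"
  shows "integrable torus_measure (\<lambda>\<theta>. h \<theta> * f \<theta>) \<and> (\<integral>\<theta>. h \<theta> * f \<theta> \<partial>torus_measure) = 0"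
  using assms
proof induction
  case (trig_poly_character m)
  show ?case
    using orth integrable_mult_bounded[OF measurable_torus_measure[OF borel_measurable_character], of m 1] by simp
next
  case (trig_poly_add f g)
  then show ?case by (simp add: distrib_left)
next
  case (trig_poly_cmult f c)
  then show ?case by (simp add: mult.left_commute[of _ c])
qed

text \<open>A polynomial within \<open>e\<close> of \<open>g\<close> on the product of circles
  contributes integral 0, so the integral is at most \<open>e\<close> times the
  \<open>L\<^sup>1\<close> norm \<open>N\<close> of \<open>h\<close>. The bound \<open>C\<close>
  serves integrability.\<close>

lemma integral_continuous_eq_0:
  fixes g :: "complex^'d \<Rightarrow> real"
  assumes g: "continuous_on UNIV g" "\<And>z. \<bar>g z\<bar> \<le> C"
  shows "(\<integral>\<theta>. h \<theta> * complex_of_real (g (torus_embedding \<theta>)) \<partial>torus_measure) = 0" (is "?I = 0")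
proof -
  have gm: "(\<lambda>\<theta>. complex_of_real (g (torus_embedding \<theta>))) \<in> borel_measurable torus_measure"
    by (intro measurable_torus_measure borel_measurable_continuous_onI continuous_intros
        continuous_on_compose2[OF g(1) continuous_on_torus_embedding]) auto
  have gi: "integrable torus_measure (\<lambda>\<theta>. h \<theta> * complex_of_real (g (torus_embedding \<theta>)))"
    using g(2) by (intro integrable_mult_bounded[OF gm, of C]) simp
  define N where "N = (\<integral>\<theta>. cmod (h \<theta>) \<partial>torus_measure)"
  have N: "N \<ge> 0" by (simp add: N_def)
  have bound: "cmod ?I \<le> e * N" if e: "e > 0" for e
  proof -
    obtain p where p: "real_polynomial_function p"
      "\<And>z. z \<in> {z. \<forall>s. cmod (z $ s) = 1} \<Longrightarrow> \<bar>g z - p z\<bar> < e"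
      using Stone_Weierstrass_real_polynomial_function[OF compact_torus_image continuous_on_subset[OF g(1) subset_UNIV] e]
      by metis
    let ?p = "\<lambda>\<theta>. complex_of_real (p (torus_embedding \<theta>))"
    note P = integral_trig_poly[OF trig_poly_real_polynomial[OF p(1)]]
    have "?I = (\<integral>\<theta>. h \<theta> * complex_of_real (g (torus_embedding \<theta>)) - h \<theta> * ?p \<theta> \<partial>torus_measure)"
      using gi P by simp
    also have "cmod \<dots> \<le> (\<integral>\<theta>. e * cmod (h \<theta>) \<partial>torus_measure)"
    proof (rule Bochner_Integration.integral_norm_bound_integral)
      fix \<theta> :: "real^'d"
      have "\<bar>g (torus_embedding \<theta>) - p (torus_embedding \<theta>)\<bar> < e"
        by (rule p(2)) (simp add: torus_embedding_def)
      then have "cmod (complex_of_real (g (torus_embedding \<theta>)) - ?p \<theta>) \<le> e"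
        unfolding of_real_diff[symmetric] norm_of_real by (rule less_imp_le)
      then show "cmod (h \<theta> * complex_of_real (g (torus_embedding \<theta>)) - h \<theta> * ?p \<theta>) \<le> e * cmod (h \<theta>)"
        unfolding right_diff_distrib[symmetric] norm_mult
        by (subst mult.commute) (rule mult_right_mono, simp_all)
    qed (use gi P h in auto)
    finally show ?thesis by (simp add: N_def)
  qed
  have "cmod ?I \<le> 0"
  proof (cases "N = 0")
    case False
    show ?thesis
    proof (rule field_le_epsilon)
      fix e :: real assume "e > 0"
      then show "cmod ?I \<le> 0 + e"
        using bound[of "e / N"] False N by simp
    qed
  qed (use bound[of 1] in simp)
  then show ?thesis by simp
qed

lemma integral_closed_eq_0:
  assumes "closed C"
  shows "(\<integral>\<theta>. h \<theta> * indicator C (torus_embedding \<theta>) \<partial>torus_measure) = 0"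
\<comment> \<open>The distance to the empty set is 0 by convention, so the cutoff functions below
  would not converge to its indicator.\<close>
proof (cases "C = {}")
  case False
  \<comment> \<open>Continuous cutoffs that are 1 on \<open>C\<close> and, for positive
    \<open>n\<close>, 0 at distance at least \<open>1 / n\<close> from it; closedness of
    \<open>C\<close> makes them tend to its indicator.\<close>
  define g where "g n z = max 0 (1 - real n * infdist z C)" for n and z :: "complex^'d"
  have g_cont: "continuous_on UNIV (g n)" for n
    unfolding g_def by (intro continuous_intros)
  have g_bound: "\<bar>g n z\<bar> \<le> 1" for n z
    by (auto simp: g_def infdist_nonneg)
  have "(\<lambda>n. \<integral>\<theta>. h \<theta> * complex_of_real (g n (torus_embedding \<theta>)) \<partial>torus_measure)
      \<longlonglongrightarrow> (\<integral>\<theta>. h \<theta> * indicator C (torus_embedding \<theta>) \<partial>torus_measure)"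
  proof (rule integral_dominated_convergence)
    show "integrable torus_measure (\<lambda>\<theta>. cmod (h \<theta>))"
      using h by simp
    have hm: "h \<in> borel_measurable torus_measure"
      using h by auto
    show "(\<lambda>\<theta>. h \<theta> * indicator C (torus_embedding \<theta>)) \<in> borel_measurable torus_measure"
      using assms
      by (intro borel_measurable_times hm measurable_torus_measure
          measurable_compose[OF borel_measurable_torus_embedding] borel_measurable_indicator) auto
    show "(\<lambda>\<theta>. h \<theta> * complex_of_real (g n (torus_embedding \<theta>))) \<in> borel_measurable torus_measure" for n
      by (intro borel_measurable_times hm measurable_torus_measure borel_measurable_continuous_onI continuous_intros
        continuous_on_compose2[OF g_cont continuous_on_torus_embedding]) auto
    show "AE \<theta> in torus_measure. norm (h \<theta> * complex_of_real (g n (torus_embedding \<theta>))) \<le> cmod (h \<theta>)" for n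
      using g_bound by (intro AE_I2) (simp add: norm_mult mult_left_le)
    have lim: "(\<lambda>n. g n z) \<longlonglongrightarrow> indicator C z" for z
    proof (cases "z \<in> C")
      case True
      then show ?thesis by (simp add: g_def)
    next
      case z: False
      then have pos: "infdist z C > 0"
        using assms False by (meson infdist_pos_not_in_closed)
      obtain n0 where n0: "1 / infdist z C < real n0"
        using reals_Archimedean2 by blast
      have "g n z = 0" if "n \<ge> n0" for n
      proof -
        have "1 < real n0 * infdist z C"
          using n0 pos by (simp add: field_simps)
        also have "\<dots> \<le> real n * infdist z C"
          using that pos by simp
        finally show ?thesis by (simp add: g_def)
      qed
      then have "\<forall>\<^sub>F n in sequentially. g n z = 0"
        by (rule eventually_sequentiallyI)
      then show ?thesis
        using z by (simp add: tendsto_eventually)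
    qed
    have "complex_of_real (indicator C z) = indicator C z" for z
      by (simp add: indicator_def)
    then have "(\<lambda>n. h \<theta> * complex_of_real (g n z)) \<longlonglongrightarrow> h \<theta> * indicator C z" for \<theta> z
      using tendsto_mult[OF tendsto_const tendsto_of_real[OF lim[of z]], of "h \<theta>"] by simp
    then show "AE \<theta> in torus_measure. (\<lambda>n. h \<theta> * complex_of_real (g n (torus_embedding \<theta>)))
        \<longlonglongrightarrow> h \<theta> * indicator C (torus_embedding \<theta>)"
      by simp
  qed
  moreover have "(\<integral>\<theta>. h \<theta> * complex_of_real (g n (torus_embedding \<theta>)) \<partial>torus_measure) = 0" for n
    by (rule integral_continuous_eq_0[OF g_cont g_bound])
  ultimately show ?thesis
    by (simp add: LIMSEQ_const_iff)
qed simp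

lemma integral_borel_eq_0:
  fixes A :: "(complex^'d) set"
  assumes "A \<in> sets borel"
  shows "(LINT \<theta>:torus_embedding -` A \<inter> torus|torus_measure. h \<theta>) = 0"
proof -
  have hi: "set_integrable torus_measure B h" if "B \<in> sets torus_measure" for B
    using h that unfolding set_integrable_def by (rule integrable_mult_indicator[rotated])
  have pre: "torus_embedding -` B \<inter> torus \<in> sets torus_measure" if "B \<in> sets borel" for B :: "(complex^'d) set"
    using measurable_sets[OF measurable_torus_measure[OF borel_measurable_torus_embedding] that] by simp
  have eq: "(LINT \<theta>:torus_embedding -` B \<inter> torus|torus_measure. h \<theta>)
      = (\<integral>\<theta>. h \<theta> * indicator B (torus_embedding \<theta>) \<partial>torus_measure)" for B
    unfolding set_lebesgue_integral_def
    by (rule Bochner_Integration.integral_cong) (auto simp: indicator_def)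
  have "Int_stable (Collect closed :: (complex^'d) set set)" "Collect closed \<subseteq> Pow (UNIV :: (complex^'d) set)"
    by (auto simp: Int_stable_def)
  moreover have "A \<in> sigma_sets UNIV (Collect closed)"
    using assms by (simp add: borel_eq_closed)
  ultimately show ?thesis
  proof (induction A rule: sigma_sets_induct_disjoint)
    case (basic A)
    then show ?case
      unfolding eq by (auto intro: integral_closed_eq_0)
  next
    case (compl A)
    then have A: "A \<in> sets borel"
      by (simp add: borel_eq_closed)
    \<comment> \<open>Passing to complements requires the total integral to vanish; it does, since
      the whole space is itself closed.\<close>
    have "(LINT \<theta>:torus_embedding -` UNIV \<inter> torus|torus_measure. h \<theta>) = 0"
      unfolding eq by (rule integral_closed_eq_0) simp
    moreover have "torus_embedding -` UNIV \<inter> torus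
        = (torus_embedding -` A \<inter> torus) \<union> (torus_embedding -` (UNIV - A) \<inter> torus)"
      by auto
    moreover have "(LINT \<theta>:(torus_embedding -` A \<inter> torus) \<union> (torus_embedding -` (UNIV - A) \<inter> torus)|torus_measure. h \<theta>)
        = (LINT \<theta>:torus_embedding -` A \<inter> torus|torus_measure. h \<theta>)
          + (LINT \<theta>:torus_embedding -` (UNIV - A) \<inter> torus|torus_measure. h \<theta>)"
      using A by (intro set_integral_Un hi pre) auto
    ultimately show ?case
      using compl.IH by simp
  next
    case (union B)
    have B: "B i \<in> sets borel" for i
      using union by (auto simp: borel_eq_closed)
    have "torus_embedding -` (\<Union>i. B i) \<inter> torus = (\<Union>i. torus_embedding -` B i \<inter> torus)"
      by auto
    moreover have "(LINT \<theta>:(\<Union>i. torus_embedding -` B i \<inter> torus)|torus_measure. h \<theta>)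
        = (\<Sum>i. LINT \<theta>:torus_embedding -` B i \<inter> torus|torus_measure. h \<theta>)"
      using union(1) B
      by (intro lebesgue_integral_countable_add hi sets.countable_UN image_subsetI pre B)
        (auto simp: disjoint_family_on_def)
    ultimately show ?case
      using union by simp
  qed (simp add: set_lebesgue_integral_def)
qed

text \<open>Taking \<open>Arg2pi\<close> in each component is a Borel left inverse of the embedding
  on the cube. Hence every measurable subset of the cube is the trace of the preimage of a Borel set
  under the embedding, and \<open>h\<close> integrates to 0 over it.\<close>

lemma eq_0_if_orthogonal: "AE \<theta> in torus_measure. h \<theta> = 0"
proof -
  interpret finite_measure "torus_measure :: (real^'d) measure"
    by (rule finite_measure_torus)
  \<comment> \<open>\<open>Arg2pi\<close> jumps along the positive real axis, but its sublevel sets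
    are closed.\<close>
  have arg[measurable]: "Arg2pi \<in> borel_measurable borel"
    by (rule borel_measurable_iff_le[THEN iffD2]) (simp add: closed_Arg2pi2pi_le borel_closed)
  define a :: "complex^'d \<Rightarrow> real^'d" where "a z = (\<chi> s. Arg2pi (z $ s))" for z
  have "(\<lambda>z. a z \<bullet> b) \<in> borel_measurable borel" if b: "b \<in> Basis" for b
  proof -
    obtain s where "b = axis s 1"
      using b by (auto simp: Basis_vec_def)
    moreover have "(\<lambda>z. Arg2pi (z $ s)) \<in> borel_measurable borel"
      by (intro measurable_compose[OF _ arg] borel_measurable_continuous_onI continuous_intros)
    ultimately show ?thesis
      by (simp add: a_def inner_axis)
  qed
  then have a: "a \<in> borel_measurable borel"
    by (subst borel_measurable_euclidean_space) auto
  have inv: "a (torus_embedding \<theta>) = \<theta>" if "\<theta> \<in> torus" for \<theta>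
    using that by (auto simp: a_def torus_embedding_def torus_def vec_eq_iff cis_conv_exp Arg2pi_exp)
  have "(LINT \<theta>:A|torus_measure. h \<theta>) = (LINT \<theta>:A|torus_measure. 0)" if "A \<in> sets torus_measure" for A :: "(real^'d) set"
  proof -
    have A: "A \<in> sets borel" "A \<subseteq> torus"
      using that unfolding sets_torus_measure by (auto simp: sets_restrict_space sets_torus)
  then have "torus_embedding -` (a -` A) \<inter> torus = A"
    using inv by auto
  moreover have "(LINT \<theta>:torus_embedding -` (a -` A) \<inter> torus|torus_measure. h \<theta>) = 0"
    using measurable_sets[OF a A(1)] by (intro integral_borel_eq_0) (simp add: Int_absorb)
  ultimately show ?thesis
    by (simp add: set_lebesgue_integral_def)
  qed
  then show ?thesis
    by (intro density_unique_banach[OF h]) simp_all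
qed

end

interpretation torus: complete_orthonormal_family "torus_measure :: (real^'d) measure" "\<lambda>m :: int^'d. character (- m)"
proof -
  interpret orthonormal_family "torus_measure :: (real^'d) measure" "\<lambda>m :: int^'d. character (- m)"
    by (rule orthonormal_characters)
  show "complete_orthonormal_family (torus_measure :: (real^'d) measure) (\<lambda>m :: int^'d. character (- m))"
  proof
    fix h :: "real^'d \<Rightarrow> complex"
    assume h: "square_integrable torus_measure h" and 0: "\<And>m. coef h m = 0"
    show "AE \<theta> in torus_measure. h \<theta> = 0"
    proof (rule eq_0_if_orthogonal)
      show "integrable torus_measure h"
        using h by (rule integrable_if_square_integrable)
      show "(\<integral>\<theta>. h \<theta> * character m \<theta> \<partial>torus_measure) = 0" for m
        using 0[of m] by (simp add: coef_def cnj_character)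
    qed
  qed
qed

section \<open>Multiplication by characters and square integrable vector functions\<close>

lemma square_integrable_character_mult:
  assumes "square_integrable torus_measure g"
  shows "square_integrable torus_measure (\<lambda>\<theta>. character m \<theta> * g \<theta>)"
  using assms measurable_torus_measure[OF borel_measurable_character, of m]
  by (auto simp: square_integrable_def norm_mult)

lemma coef_character_mult: "torus.coef (\<lambda>\<theta>. character n \<theta> * g \<theta>) m = torus.coef g (m + n)"
  unfolding torus.coef_def cnj_character by (simp add: character_add ac_simps)

text \<open>The squared norm is the finite sum of the squared components, and measurability can be
  tested on inner products with basis vectors. Thus the scalar theory of Fourier coefficients
  applies to each component.\<close>

lemma L2_iff: "g \<in> L2 \<longleftrightarrow> (\<forall>j. square_integrable torus_measure (\<lambda>\<theta>. g \<theta> $ j))"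
  for g :: "real^'d \<Rightarrow> complex^'n"
proof
  assume g: "g \<in> L2"
  show "\<forall>j. square_integrable torus_measure (\<lambda>\<theta>. g \<theta> $ j)"
  proof
    fix j
    have "(\<lambda>z :: complex^'n. z $ j) \<in> borel_measurable borel"
      by (intro borel_measurable_continuous_onI continuous_intros)
    then have meas: "(\<lambda>\<theta>. g \<theta> $ j) \<in> borel_measurable torus_measure"
      using g by (auto simp: L2_def intro: measurable_compose)
    have "integrable torus_measure (\<lambda>\<theta>. (norm (g \<theta>))\<^sup>2)"
      using g by (simp add: L2_def)
    moreover have "(\<lambda>\<theta>. (cmod (g \<theta> $ j))\<^sup>2) \<in> borel_measurable torus_measure"
      using meas by (intro borel_measurable_power measurable_compose[OF _ borel_measurable_norm])
    moreover have "AE \<theta> in torus_measure. norm ((cmod (g \<theta> $ j))\<^sup>2) \<le> norm ((norm (g \<theta>))\<^sup>2)"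
      by (intro AE_I2) (simp add: Finite_Cartesian_Product.norm_nth_le power_mono)
    ultimately have "integrable torus_measure (\<lambda>\<theta>. (cmod (g \<theta> $ j))\<^sup>2)"
      by (rule Bochner_Integration.integrable_bound)
    with meas show "square_integrable torus_measure (\<lambda>\<theta>. g \<theta> $ j)"
      by (simp add: square_integrable_def)
  qed
next
  assume g: "\<forall>j. square_integrable torus_measure (\<lambda>\<theta>. g \<theta> $ j)"
  have "(\<lambda>\<theta>. g \<theta> \<bullet> b) \<in> borel_measurable torus_measure" if b: "b \<in> Basis" for b
  proof -
    obtain j u where "b = axis j u"
      using b by (auto simp: Basis_vec_def)
    moreover have "(\<lambda>\<theta>. g \<theta> $ j) \<in> borel_measurable torus_measure"
      using g by (simp add: square_integrable_def)
    then have "(\<lambda>\<theta>. g \<theta> $ j \<bullet> u) \<in> borel_measurable torus_measure"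
      by (intro borel_measurable_inner) auto
    ultimately show ?thesis
      by (simp add: inner_axis)
  qed
  then have "g \<in> borel_measurable torus_measure"
    by (subst borel_measurable_euclidean_space) auto
  moreover have "(norm (g \<theta>))\<^sup>2 = (\<Sum>j\<in>UNIV. (cmod (g \<theta> $ j))\<^sup>2)" for \<theta>
    by (simp add: norm_vec_def L2_set_def sum_nonneg)
  ultimately show "g \<in> L2"
    using g by (simp add: L2_def square_integrable_def)
qed

section \<open>Arcs of periodic graphs and their orbits\<close>

definition arcs_from :: "('v, 'e) pre_digraph \<Rightarrow> 'v \<Rightarrow> 'e set" where
  "arcs_from G u = {e \<in> arcs G. tail G e = u}"

text \<open>An unoriented edge at \<open>u\<close> corresponds to one arc from \<open>u\<close>, or to two if it is a loop.\<close>

context bidirected_digraph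
begin

lemma incident_edges_eq: "incident_edges G arev u = (\<lambda>e. {e, arev e}) ` arcs_from G u"
proof (intro equalityI subsetI)
  fix E assume "E \<in> incident_edges G arev u"
  then obtain e where e: "e \<in> arcs G" "E = {e, arev e}" "u = tail G e \<or> u = head G e"
    by (auto simp: incident_edges_def unoriented_edges_def)
  from e(3) show "E \<in> (\<lambda>e. {e, arev e}) ` arcs_from G u"
  proof
    assume "u = tail G e"
    with e show ?thesis by (auto simp: arcs_from_def)
  next
    assume "u = head G e"
    then have "arev e \<in> arcs_from G u" "E = {arev e, arev (arev e)}"
      using e by (auto simp: arcs_from_def)
    then show ?thesis by blast
  qed
next
  fix E assume "E \<in> (\<lambda>e. {e, arev e}) ` arcs_from G u"
  then show "E \<in> incident_edges G arev u"
    by (auto simp: incident_edges_def unoriented_edges_def arcs_from_def)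
qed

lemma loops_at_eq: "loops_at G arev u = (\<lambda>e. {e, arev e}) ` {e \<in> arcs_from G u. head G e = u}"
proof (intro equalityI subsetI)
  fix E assume "E \<in> loops_at G arev u"
  then obtain e where "e \<in> arcs G" "E = {e, arev e}" "tail G ` {e, arev e} = {u}"
    by (auto simp: loops_at_def unoriented_edges_def)
  then show "E \<in> (\<lambda>e. {e, arev e}) ` {e \<in> arcs_from G u. head G e = u}"
    by (intro image_eqI[where x = e]) (auto simp: arcs_from_def)
qed (auto simp: loops_at_def unoriented_edges_def arcs_from_def)

text \<open>If two such arcs give the same unoriented edge and differ, one is the reversal of the
  other; then its tail \<open>u\<close> would be the head of the other.\<close>

lemma inj_on_unoriented_nonloops: "inj_on (\<lambda>e. {e, arev e}) {e \<in> arcs_from G u. head G e \<noteq> u}"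
proof (rule inj_onI)
  fix e e' assume e: "e \<in> {e \<in> arcs_from G u. head G e \<noteq> u}" and e': "e' \<in> {e \<in> arcs_from G u. head G e \<noteq> u}"
    and eq: "{e, arev e} = {e', arev e'}"
  show "e = e'"
  proof (rule ccontr)
    assume "e \<noteq> e'"
    then have "e = arev e'"
      using eq by auto
    then show False
      using e e' by (auto simp: arcs_from_def)
  qed
qed

lemma loops_disjoint_nonloops:
  "(\<lambda>e. {e, arev e}) ` {e \<in> arcs_from G u. head G e = u}
    \<inter> (\<lambda>e. {e, arev e}) ` {e \<in> arcs_from G u. head G e \<noteq> u} = {}"
  by (auto simp: arcs_from_def doubleton_eq_iff)

lemma arcs_from_split:
  "arcs_from G u = {e \<in> arcs_from G u. head G e = u} \<union> {e \<in> arcs_from G u. head G e \<noteq> u}"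
  by auto

lemma degree_eq_card_arcs_from:
  assumes fin: "finite (arcs_from G u)"
  shows "degree G arev u = card (arcs_from G u)"
proof -
  let ?\<phi> = "\<lambda>e. {e, arev e}"
  let ?L = "{e \<in> arcs_from G u. head G e = u}" and ?N = "{e \<in> arcs_from G u. head G e \<noteq> u}"
  have finL: "finite ?L" "finite ?N"
    using fin by auto
  \<comment> \<open>An unoriented loop comes from exactly two arcs, since \<open>arev\<close> has no
    fixed point; this matches the second count of loops in \<open>degree\<close>.\<close>
  have "card {e \<in> ?L. ?\<phi> e = E} = 2" if E: "E \<in> ?\<phi> ` ?L" for E
  proof -
    obtain e where e: "e \<in> ?L" "E = {e, arev e}"
      using E by (rule imageE)
    then have "{e \<in> ?L. ?\<phi> e = E} = {e, arev e}"
      by (auto simp: arcs_from_def doubleton_eq_iff)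
    moreover have "arev e \<noteq> e"
      using e by (auto simp: arcs_from_def arev_dom)
    ultimately show ?thesis
      by simp
  qed
  then have "card ?L = 2 * card (?\<phi> ` ?L)"
    using sum.image_gen[OF finL(1), of "\<lambda>_. 1 :: nat" ?\<phi>] by simp
  moreover have "incident_edges G arev u = ?\<phi> ` ?L \<union> ?\<phi> ` ?N"
    unfolding incident_edges_eq image_Un[symmetric] by (subst arcs_from_split) (rule refl)
  then have "card (incident_edges G arev u) = card (?\<phi> ` ?L) + card ?N"
    using card_Un_disjoint[OF finite_imageI finite_imageI loops_disjoint_nonloops] finL
      card_image[OF inj_on_unoriented_nonloops] by simp
  moreover have "card (arcs_from G u) = card ?L + card ?N"
    using finL by (subst arcs_from_split, intro card_Un_disjoint) auto
  ultimately show ?thesis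
    by (simp add: degree_def loops_at_eq)
qed

end

lemma lattice_vec_add: "lattice_vec a (m + n) = lattice_vec a m + lattice_vec a n"
  by (simp add: lattice_vec_def scaleR_left_distrib sum.distrib)

lemma lattice_vec_zero[simp]: "lattice_vec a 0 = 0"
  by (simp add: lattice_vec_def)

lemma lattice_vec_minus: "lattice_vec a (- m) = - lattice_vec a m"
  by (simp add: lattice_vec_def sum_negf)

section \<open>Translations of arcs, orbits of arcs, and the existence of bridges\<close>

context periodic_graph
begin

lemma lattice_vec_eq_iff: "lattice_vec a m = lattice_vec a n \<longleftrightarrow> m = n"
  using int_part_add_lattice[of 0 0 m] int_part_add_lattice[of 0 0 n] by (metis add_left_cancel)

lemma cell_part_add_int_part: "cell_part a p x + lattice_vec a (int_part a p x) = x"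
  by (simp add: cell_part_def)

lemma cell_iff: "x \<in> cell a p \<longleftrightarrow> int_part a p x = 0"
  by (auto simp: cell_def int_part_def vec_eq_iff floor_eq_iff)

lemma int_part_cell: "x \<in> cell a p \<Longrightarrow> int_part a p x = 0"
  by (simp add: cell_iff)

lemma cell_part_cell: "x \<in> cell a p \<Longrightarrow> cell_part a p x = x"
  by (simp add: cell_part_def int_part_cell)

lemma int_part_cell_part: "int_part a p (cell_part a p x) = 0"
  using int_part_add_lattice[of p "cell_part a p x" "int_part a p x"] cell_part_add_int_part[of p x] by simp

lemma cell_part_in_verts: "x \<in> verts G \<Longrightarrow> cell_part a p x \<in> verts G"
  using verts_shift[of x "- int_part a p x"] by (simp add: cell_part_def lattice_vec_minus)

lemma finite_arcs_from: "finite (arcs_from G u)"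
proof (cases "u \<in> verts G")
  case True
  show ?thesis
    by (rule finite_subset[OF _ finite_degree[OF True]]) (auto simp: arcs_from_def)
next
  case False
  then have "arcs_from G u = {}"
    using tail_in_verts by (auto simp: arcs_from_def)
  then show ?thesis by simp
qed

lemma shift_minus_shift: "e \<in> arcs G \<Longrightarrow> shift (- m) (shift m e) = e"
  using shift_add[of e "- m" m] by (simp add: shift_zero)

lemma inj_on_shift: "inj_on (shift m) (arcs G)"
  by (rule inj_on_inverseI[where g = "shift (- m)"]) (rule shift_minus_shift)

lemma arcs_from_add_lattice: "arcs_from G (u + lattice_vec a m) = shift m ` arcs_from G u"
proof (intro equalityI subsetI)
  fix e assume e: "e \<in> arcs_from G (u + lattice_vec a m)"
  then have "shift (- m) e \<in> arcs_from G u"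
    by (simp add: arcs_from_def arcs_shift tail_shift lattice_vec_minus)
  moreover have "shift m (shift (- m) e) = e"
    using e shift_minus_shift[of e "- m"] by (simp add: arcs_from_def)
  ultimately show "e \<in> shift m ` arcs_from G u"
    by (metis imageI)
qed (auto simp: arcs_from_def arcs_shift tail_shift)

lemma sum_arcs_from_add_lattice:
  "(\<Sum>e\<in>arcs_from G (u + lattice_vec a m). F e) = (\<Sum>e\<in>arcs_from G u. F (shift m e))"
  unfolding arcs_from_add_lattice
  by (subst sum.reindex) (auto intro: inj_on_subset[OF inj_on_shift] simp: arcs_from_def)

lemma degree_add_lattice: "degree G arev (u + lattice_vec a m) = degree G arev u"
  unfolding degree_eq_card_arcs_from[OF finite_arcs_from] arcs_from_add_lattice
  by (intro card_image inj_on_subset[OF inj_on_shift]) (auto simp: arcs_from_def)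

text \<open>A loop is one unoriented edge but two arcs from \<open>u\<close>; the mismatch is
  harmless because its terms are \<open>f u - f u\<close> on both sides. The other edges at
  \<open>u\<close> correspond to arcs one to one.\<close>

lemma laplacian_eq_sum_arcs_from:
  "laplacian G arev f u = (\<Sum>e\<in>arcs_from G u. f u - f (head G e))"
proof -
  note fin = finite_arcs_from[of u]
  let ?\<phi> = "\<lambda>e. {e, arev e}"
  let ?L = "{e \<in> arcs_from G u. head G e = u}" and ?N = "{e \<in> arcs_from G u. head G e \<noteq> u}"
  have finL: "finite ?L" "finite ?N"
    using fin by auto
  have other: "other_end G (?\<phi> e) u = head G e" if "e \<in> arcs_from G u" for e
    using that other_end_eq[of e] by (simp add: arcs_from_def)
  have "incident_edges G arev u = ?\<phi> ` ?L \<union> ?\<phi> ` ?N"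
    unfolding incident_edges_eq image_Un[symmetric] by (subst arcs_from_split) (rule refl)
  then have "laplacian G arev f u
      = (\<Sum>E\<in>?\<phi> ` ?L. f u - f (other_end G E u)) + (\<Sum>E\<in>?\<phi> ` ?N. f u - f (other_end G E u))"
    unfolding laplacian_def using sum.union_disjoint[OF finite_imageI finite_imageI loops_disjoint_nonloops] finL
    by simp
  also have "(\<Sum>E\<in>?\<phi> ` ?L. f u - f (other_end G E u)) = 0"
    by (rule sum.neutral) (auto simp: other)
  also have "(\<Sum>E\<in>?\<phi> ` ?N. f u - f (other_end G E u)) = (\<Sum>e\<in>?N. f u - f (head G e))"
    by (subst sum.reindex[OF inj_on_unoriented_nonloops]) (auto simp: other intro!: sum.cong)
  also have "0 + (\<Sum>e\<in>?N. f u - f (head G e)) = (\<Sum>e\<in>arcs_from G u. f u - f (head G e))"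
    using fin by (auto intro!: sum.mono_neutral_left)
  finally show ?thesis .
qed

text \<open>The loop terms are not cancelled: \<open>degree\<close> counts a loop twice, the sum
  runs over its two arcs, and the diagonal of the Floquet matrix has the same contributions.\<close>

lemma laplacian_add_lattice:
  "laplacian G arev f (u + lattice_vec a m)
    = of_nat (degree G arev u) * f (u + lattice_vec a m) - (\<Sum>e\<in>arcs_from G u. f (head G e + lattice_vec a m))"
proof -
  have "laplacian G arev f (u + lattice_vec a m)
      = (\<Sum>e\<in>arcs_from G u. f (u + lattice_vec a m) - f (head G (shift m e)))"
    unfolding laplacian_eq_sum_arcs_from sum_arcs_from_add_lattice ..
  also have "\<dots> = (\<Sum>e\<in>arcs_from G u. f (u + lattice_vec a m) - f (head G e + lattice_vec a m))"
    by (rule sum.cong) (auto simp: arcs_from_def head_shift)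
  finally show ?thesis
    by (simp add: sum_subtractf degree_eq_card_arcs_from[OF finite_arcs_from])
qed

abbreviation fundamental where
  "fundamental p \<equiv> fundamental_graph G a shift p"

text \<open>The arcs from \<open>u\<close> represent the orbits of arcs from \<open>u\<close> once each.\<close>

definition arcs_to_orbit :: "real^'d \<Rightarrow> real^'d \<Rightarrow> real^'d \<Rightarrow> 'e set" where
  "arcs_to_orbit p u w = {e \<in> arcs_from G u. cell_part a p (head G e) = w}"

lemma finite_arcs_to_orbit: "finite (arcs_to_orbit p u w)"
  using finite_arcs_from[of u] by (simp add: arcs_to_orbit_def)

lemma arc_orbit_shift: "e \<in> arcs G \<Longrightarrow> arc_orbit shift (shift m e) = arc_orbit shift e"
  unfolding arc_orbit_def
proof (intro equalityI subsetI)
  fix x assume e: "e \<in> arcs G"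
  {
    assume "x \<in> range (\<lambda>n. shift n (shift m e))"
    then obtain n where "x = shift n (shift m e)" by auto
    then show "x \<in> range (\<lambda>n. shift n e)"
      using shift_add[OF e, of n m] by (metis rangeI)
  next
    assume "x \<in> range (\<lambda>n. shift n e)"
    then obtain n where "x = shift n e" by auto
    then have "x = shift (n - m) (shift m e)"
      using shift_add[OF e, of "n - m" m] by simp
    then show "x \<in> range (\<lambda>n. shift n (shift m e))" by auto
  }
qed

text \<open>Injective because a lattice translation that keeps the tail \<open>u\<close> is by 0;
  surjective because every arc has a translate with tail in the cell, where the tail then equals
  \<open>u\<close>.\<close>

lemma bij_betw_arc_orbit:
  assumes u: "u \<in> cell a p"
  shows "bij_betw (arc_orbit shift) (arcs_to_orbit p u w) (arcs_between (fundamental p) u w)"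
  unfolding bij_betw_def
proof
  show "inj_on (arc_orbit shift) (arcs_to_orbit p u w)"
  proof (rule inj_onI)
    fix e e' assume e: "e \<in> arcs_to_orbit p u w" and e': "e' \<in> arcs_to_orbit p u w"
      and eq: "arc_orbit shift e = arc_orbit shift e'"
    have eG: "e \<in> arcs G" "tail G e = u" "tail G e' = u" "e' \<in> arcs G"
      using e e' by (auto simp: arcs_to_orbit_def arcs_from_def)
    have "shift 0 e' \<in> arc_orbit shift e'"
      by (auto simp: arc_orbit_def)
    then have "e' \<in> arc_orbit shift e"
      using eq shift_zero[OF eG(4)] by simp
    then obtain m where m: "e' = shift m e"
      by (auto simp: arc_orbit_def)
    then have "lattice_vec a m = lattice_vec a 0"
      using tail_shift[OF eG(1), of m] eG by simp
    then have "m = 0"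
      by (simp only: lattice_vec_eq_iff)
    then show "e = e'"
      using m shift_zero[OF eG(1)] by simp
  qed
  show "arc_orbit shift ` arcs_to_orbit p u w = arcs_between (fundamental p) u w"
  proof (intro equalityI subsetI)
    fix E assume "E \<in> arc_orbit shift ` arcs_to_orbit p u w"
    then obtain e where e: "e \<in> arcs G" "tail G e = u" "cell_part a p (head G e) = w" "E = arc_orbit shift e"
      by (auto simp: arcs_to_orbit_def arcs_from_def)
    moreover have "E \<in> arcs (fundamental p)"
      using e by (simp add: fundamental_graph_def)
    ultimately show "E \<in> arcs_between (fundamental p) u w"
      using u by (simp add: arcs_between_def tail_fundamental_graph head_fundamental_graph cell_part_cell)
  next
    fix E assume E: "E \<in> arcs_between (fundamental p) u w"
    then obtain e where e: "e \<in> arcs G" "E = arc_orbit shift e"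
      by (auto simp: arcs_between_def fundamental_graph_def)
    have t: "cell_part a p (tail G e) = u" and h: "cell_part a p (head G e) = w"
      using E e by (auto simp: arcs_between_def tail_fundamental_graph head_fundamental_graph)
    let ?e = "shift (- int_part a p (tail G e)) e"
    have "?e \<in> arcs_to_orbit p u w"
      using e t h by (simp add: arcs_to_orbit_def arcs_from_def arcs_shift tail_shift head_shift
          cell_part_add_lattice) (simp add: lattice_vec_minus cell_part_def)
    moreover have "E = arc_orbit shift ?e"
      using e by (simp add: arc_orbit_shift)
    ultimately show "E \<in> arc_orbit shift ` arcs_to_orbit p u w"
      by blast
  qed
qed

lemma orbit_index_arc_orbit:
  assumes "u \<in> cell a p" "e \<in> arcs_from G u"
  shows "orbit_index G a p (arc_orbit shift e) = int_part a p (head G e)"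
  using assms by (simp add: arcs_from_def orbit_index_eq edge_index_def int_part_cell)

lemma head_arcs_to_orbit:
  "e \<in> arcs_to_orbit p u w \<Longrightarrow> head G e = w + lattice_vec a (int_part a p (head G e))"
  using cell_part_add_int_part[of p "head G e"] by (auto simp: arcs_to_orbit_def)

lemma floquet_laplacian_entry:
  assumes "v j \<in> cell a p"
  shows "floquet_laplacian G arev a shift p v \<theta> $ j $ k
    = (if j = k then of_nat (degree G arev (v j)) else 0)
      - (\<Sum>e\<in>arcs_to_orbit p (v j) (v k). character (int_part a p (head G e)) \<theta>)"
proof -
  have "(\<Sum>E\<in>arcs_between (fundamental p) (v j) (v k). character (orbit_index G a p E) \<theta>)
      = (\<Sum>e\<in>arcs_to_orbit p (v j) (v k). character (orbit_index G a p (arc_orbit shift e)) \<theta>)"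
    by (rule sum.reindex_bij_betw[OF bij_betw_arc_orbit[OF assms], symmetric])
  also have "\<dots> = (\<Sum>e\<in>arcs_to_orbit p (v j) (v k). character (int_part a p (head G e)) \<theta>)"
    by (rule sum.cong) (auto simp: arcs_to_orbit_def orbit_index_arc_orbit[OF assms])
  finally show ?thesis
    by (simp add: floquet_laplacian_def character_def)
qed

lemma exists_bridge:
  obtains e where "e \<in> arcs G" "int_part a p (head G e) \<noteq> int_part a p (tail G e)"
proof -
  have "\<exists>e\<in>arcs G. int_part a p (head G e) \<noteq> int_part a p (tail G e)"
  proof (rule ccontr)
    assume "\<not> ?thesis"
    then have const: "int_part a p (head G e) = int_part a p (tail G e)" if "e \<in> arcs G" for e
      using that by blast
    have sc: "strongly_connected (with_proj (mk_symmetric G))"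
      using connected by (simp add: Digraph_Component.connected_def)
    then obtain u where u: "u \<in> verts G"
      by (auto simp: strongly_connected_def)
    \<comment> \<open>Here \<open>1\<close> is the vector with all components 1, a nonzero lattice
      element. Connectedness refers to the symmetrised graph, so each step of the path from
      \<open>u\<close> to \<open>?w\<close> may follow an arc in either direction.\<close>
    let ?w = "u + lattice_vec a 1"
    have "?w \<in> verts G"
      using u by (rule verts_shift)
    then have "(u, ?w) \<in> rtrancl_on (verts G) (arcs_ends (with_proj (mk_symmetric G)))"
      using sc u by (auto simp: strongly_connected_def reachable_def)
    then have "int_part a p ?w = int_part a p u"
    proof (induction rule: rtrancl_on_induct)
      case (step y z)
      then obtain e where "e \<in> arcs G" "(y, z) \<in> {(tail G e, head G e), (head G e, tail G e)}"
        by (auto simp: parcs_mk_symmetric)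
      then show ?case
        using step const[of e] by auto
    qed simp
    then show False
      by (simp add: int_part_add_lattice vec_eq_iff)
  qed
  then show ?thesis
    using that by blast
qed

end

text \<open>All characters enter with coefficient 1, so those that belong to the same nonzero
  \<open>\<tau> e\<close> cannot cancel, and multiplicities in \<open>S\<close> do no harm.\<close>

lemma sum_character_constant_on_iff:
  fixes \<tau> :: "'b \<Rightarrow> int^'d"
  assumes fin: "finite S"
  shows "(\<lambda>\<theta>. c - (\<Sum>e\<in>S. character (\<tau> e) \<theta>)) constant_on torus \<longleftrightarrow> (\<forall>e\<in>S. \<tau> e = 0)"
proof
  assume "(\<lambda>\<theta>. c - (\<Sum>e\<in>S. character (\<tau> e) \<theta>)) constant_on torus"
  then obtain y where y: "\<And>\<theta>. \<theta> \<in> torus \<Longrightarrow> c - (\<Sum>e\<in>S. character (\<tau> e) \<theta>) = y"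
    by (auto simp: constant_on_def)
  have "character n 0 = 1" for n :: "int^'d"
    by (simp add: character_def)
  then have "c - of_nat (card S) = y"
    using y[of 0] by (simp add: torus_def)
  then have sum: "(\<Sum>e\<in>S. character (\<tau> e) \<theta>) = of_nat (card S)" if "\<theta> \<in> torus" for \<theta>
    using y[OF that] by (simp add: algebra_simps)
  show "\<forall>e\<in>S. \<tau> e = 0"
  proof (rule ballI, rule ccontr)
    fix e assume e: "e \<in> S" and "\<tau> e \<noteq> 0"
    then obtain s where s: "\<tau> e $ s \<noteq> 0"
      by (auto simp: vec_eq_iff)
    \<comment> \<open>The angle at which \<open>character (\<tau> e)\<close> takes the value -1 on
      the \<open>s\<close>-axis; a nonzero integer has absolute value at least 1, so
      \<open>t \<le> pi\<close> and the point stays in the cube.\<close>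
    define t where "t = pi / \<bar>real_of_int (\<tau> e $ s)\<bar>"
    have "1 \<le> \<bar>real_of_int (\<tau> e $ s)\<bar>"
      using s by linarith
    then have "0 \<le> t" "t \<le> pi"
      using pi_gt_zero by (auto simp: t_def field_simps mult_left_mono)
    moreover have "t < 2 * pi"
      using \<open>t \<le> pi\<close> pi_gt_zero by linarith
    ultimately have t: "axis s t \<in> (torus :: (real^'d) set)"
      by (simp add: torus_def axis_def)
    have "real_of_int (\<tau> e $ s) * t = pi \<or> real_of_int (\<tau> e $ s) * t = - pi"
      using s by (auto simp: t_def abs_if field_simps)
    then have "Re (character (\<tau> e) (axis s t)) = - 1"
      by (auto simp: character_eq_cis inner_axis)
    moreover have "Re (character (\<tau> d) (axis s t)) \<le> 1" for d
      using complex_Re_le_cmod[of "character (\<tau> d) (axis s t)"] by simp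
    ultimately have "(\<Sum>d\<in>S. Re (character (\<tau> d) (axis s t))) < (\<Sum>d\<in>S. 1)"
      using fin e by (intro sum_strict_mono_ex1) (auto intro!: bexI[of _ e])
    also have "\<dots> = Re (\<Sum>d\<in>S. character (\<tau> d) (axis s t))"
      using sum[OF t] by simp
    finally show False by simp
  qed
next
  assume "\<forall>e\<in>S. \<tau> e = 0"
  then show "(\<lambda>\<theta>. c - (\<Sum>e\<in>S. character (\<tau> e) \<theta>)) constant_on torus"
    by (auto simp: constant_on_def)
qed

section \<open>The Floquet transform\<close>

locale floquet_graph = periodic_graph G arev a shift
  for G :: "(real^'d, 'e) pre_digraph" and arev :: "'e \<Rightarrow> 'e" and a :: "'d \<Rightarrow> real^'d"
    and shift :: "int^'d \<Rightarrow> 'e \<Rightarrow> 'e" +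
  fixes p :: "real^'d" and v :: "'n::finite \<Rightarrow> real^'d" and Q :: "real^'d \<Rightarrow> real"
  assumes bij_v: "bij_betw v UNIV (verts (fundamental_graph G a shift p))"
    and Q_periodic: "\<And>x m. x \<in> verts G \<Longrightarrow> Q (x + lattice_vec a m) = Q x"
begin

lemma v_in_verts: "v j \<in> verts G" and v_in_cell: "v j \<in> cell a p"
  using bij_betwE[OF bij_v] by (auto simp: fundamental_graph_def)

lemma v_eq_iff: "v j = v k \<longleftrightarrow> j = k"
  using bij_betw_imp_inj_on[OF bij_v] by (auto dest: injD)

lemma vertex_cases:
  assumes "x \<in> verts G"
  obtains j where "cell_part a p x = v j"
proof -
  have "cell_part a p x \<in> verts (fundamental_graph G a shift p)"
    using assms by (simp add: fundamental_graph_def cell_part_in_verts cell_iff int_part_cell_part)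
  then show ?thesis
    using that bij_betw_imp_surj_on[OF bij_v] by blast
qed

lemma cell_part_v: "cell_part a p (v j + lattice_vec a m) = v j"
  by (simp add: cell_part_add_lattice cell_part_cell v_in_cell)

lemma int_part_v: "int_part a p (v j + lattice_vec a m) = m"
  by (simp add: int_part_add_lattice int_part_cell v_in_cell)

definition fiber :: "(real^'d \<Rightarrow> complex) \<Rightarrow> 'n \<Rightarrow> int^'d \<Rightarrow> complex" where
  "fiber f j m = f (v j + lattice_vec a m)"

lemma verts_eq_UN: "verts G = (\<Union>j. range (\<lambda>m. v j + lattice_vec a m))"
proof (intro equalityI subsetI)
  fix x assume "x \<in> verts G"
  then obtain j where "cell_part a p x = v j"
    by (rule vertex_cases)
  then have "x = v j + lattice_vec a (int_part a p x)"
    using cell_part_add_int_part[of p x] by simp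
  then show "x \<in> (\<Union>j. range (\<lambda>m. v j + lattice_vec a m))"
    by blast
qed (auto intro: verts_shift v_in_verts)

lemma has_sum_verts:
  fixes F :: "real^'d \<Rightarrow> 'b :: topological_comm_monoid_add"
  assumes "\<And>j. ((\<lambda>m. F (v j + lattice_vec a m)) has_sum s j) UNIV"
  shows "(F has_sum (\<Sum>j\<in>UNIV. s j)) (verts G)"
  unfolding verts_eq_UN
proof (rule sum_has_sum)
  fix j
  have "inj (\<lambda>m. v j + lattice_vec a m)"
    by (auto simp: inj_on_def lattice_vec_eq_iff)
  then show "(F has_sum s j) (range (\<lambda>m. v j + lattice_vec a m))"
    using assms[of j] by (subst has_sum_reindex) (simp_all add: o_def)
next
  fix j k :: 'n assume "j \<noteq> k"
  then show "range (\<lambda>m. v j + lattice_vec a m) \<inter> range (\<lambda>m. v k + lattice_vec a m) = {}"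
    using cell_part_v v_eq_iff by (metis (no_types, lifting) disjoint_iff imageE)
qed simp

lemma ell2_verts_iff:
  "f \<in> ell2 (verts G) \<longleftrightarrow>
    (\<forall>x. x \<notin> verts G \<longrightarrow> f x = 0) \<and> (\<forall>j. (\<lambda>m. (cmod (fiber f j m))\<^sup>2) summable_on UNIV)"
proof -
  have "(\<lambda>m. (cmod (fiber f j m))\<^sup>2) summable_on UNIV" if f: "(\<lambda>x. (cmod (f x))\<^sup>2) summable_on verts G" for j
  proof -
    have "(\<lambda>x. (cmod (f x))\<^sup>2) summable_on range (\<lambda>m. v j + lattice_vec a m)"
      using f by (rule summable_on_subset_banach) (auto simp: verts_eq_UN)
    moreover have "inj (\<lambda>m. v j + lattice_vec a m)"
      by (auto simp: inj_on_def lattice_vec_eq_iff)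
    ultimately show ?thesis
      by (subst (asm) summable_on_reindex) (simp_all add: o_def fiber_def)
  qed
  moreover have "(\<lambda>x. (cmod (f x))\<^sup>2) summable_on verts G"
    if "\<forall>j. (\<lambda>m. (cmod (fiber f j m))\<^sup>2) summable_on UNIV"
  proof -
    have "((\<lambda>m. (cmod (f (v j + lattice_vec a m)))\<^sup>2) has_sum (\<Sum>\<^sub>\<infinity>m. (cmod (fiber f j m))\<^sup>2)) UNIV" for j
      using that has_sum_infsum unfolding fiber_def by blast
    from has_sum_verts[OF this] show ?thesis
      by (rule has_sum_imp_summable)
  qed
  ultimately show ?thesis
    by (auto simp: ell2_def)
qed

lemma summable_fiber: "f \<in> ell2 (verts G) \<Longrightarrow> (\<lambda>m. (cmod (fiber f j m))\<^sup>2) summable_on UNIV"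
  by (simp add: ell2_verts_iff)

text \<open>\<open>synthesis\<close> stands in for the \<open>L\<^sup>2\<close> limit of the series
  over the orbit of \<open>v j\<close>.\<close>

definition transform :: "(real^'d \<Rightarrow> complex) \<Rightarrow> real^'d \<Rightarrow> complex^'n" where
  "transform f \<theta> = (\<chi> j. torus.synthesis (fiber f j) \<theta>)"

lemma transform_L2: "f \<in> ell2 (verts G) \<Longrightarrow> transform f \<in> L2"
  by (simp add: L2_iff transform_def torus.square_integrable_synthesis summable_fiber)

lemma coef_transform: "f \<in> ell2 (verts G) \<Longrightarrow> torus.coef (\<lambda>\<theta>. transform f \<theta> $ j) m = fiber f j m"
  by (simp add: transform_def torus.coef_synthesis summable_fiber)

text \<open>Identities between operators reduce through this to identities of coefficients; only
  finitely many exceptional null sets, one for each component, are joined.\<close>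

lemma L2_eq_if_coef_eq:
  fixes g h :: "real^'d \<Rightarrow> complex^'n"
  assumes "g \<in> L2" "h \<in> L2" "\<And>j m. torus.coef (\<lambda>\<theta>. g \<theta> $ j) m = torus.coef (\<lambda>\<theta>. h \<theta> $ j) m"
  shows "L2_eq g h"
proof -
  have "AE \<theta> in torus_measure. \<forall>j\<in>UNIV. g \<theta> $ j = h \<theta> $ j"
    using assms by (intro AE_finite_allI torus.AE_eq_if_coef_eq) (auto simp: L2_iff)
  then show ?thesis
    by (simp add: L2_eq_def vec_eq_iff)
qed

lemma coef_cong_L2_eq:
  fixes g h :: "real^'d \<Rightarrow> complex^'n"
  assumes "g \<in> L2" "h \<in> L2" "L2_eq g h"
  shows "torus.coef (\<lambda>\<theta>. g \<theta> $ j) m = torus.coef (\<lambda>\<theta>. h \<theta> $ j) m"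
proof (rule torus.coef_cong_AE)
  show "AE \<theta> in torus_measure. g \<theta> $ j = h \<theta> $ j"
    using assms(3) unfolding L2_eq_def by eventually_elim simp
qed (use assms in \<open>auto simp: L2_iff square_integrable_def\<close>)

lemma ell2_add: "f \<in> ell2 (verts G) \<Longrightarrow> g \<in> ell2 (verts G) \<Longrightarrow> (\<lambda>x. f x + g x) \<in> ell2 (verts G)"
  unfolding ell2_verts_iff
proof (intro conjI allI impI)
  fix j assume f: "(\<forall>x. x \<notin> verts G \<longrightarrow> f x = 0) \<and> (\<forall>j. (\<lambda>m. (cmod (fiber f j m))\<^sup>2) summable_on UNIV)"
    and g: "(\<forall>x. x \<notin> verts G \<longrightarrow> g x = 0) \<and> (\<forall>j. (\<lambda>m. (cmod (fiber g j m))\<^sup>2) summable_on UNIV)"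
  show "(\<lambda>m. (cmod (fiber (\<lambda>x. f x + g x) j m))\<^sup>2) summable_on UNIV"
  proof (rule summable_on_comparison_test)
    show "(\<lambda>m. 2 * (cmod (fiber f j m))\<^sup>2 + 2 * (cmod (fiber g j m))\<^sup>2) summable_on UNIV"
      using f g by (intro summable_on_add summable_on_cmult_right) auto
    show "(cmod (fiber (\<lambda>x. f x + g x) j m))\<^sup>2 \<le> 2 * (cmod (fiber f j m))\<^sup>2 + 2 * (cmod (fiber g j m))\<^sup>2" for m
      by (simp add: fiber_def cmod_add_square_le)
  qed simp
qed auto

lemma ell2_cmult: "f \<in> ell2 (verts G) \<Longrightarrow> (\<lambda>x. c * f x) \<in> ell2 (verts G)"
  by (auto simp: ell2_def norm_mult power_mult_distrib intro: summable_on_cmult_right)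

lemma L2_add: "g \<in> L2 \<Longrightarrow> h \<in> L2 \<Longrightarrow> (\<lambda>\<theta>. g \<theta> + h \<theta>) \<in> L2" for g h :: "real^'d \<Rightarrow> complex^'n"
  by (simp add: L2_iff square_integrable_add)

lemma L2_cmult: "g \<in> L2 \<Longrightarrow> (\<lambda>\<theta>. c *s g \<theta>) \<in> L2" for g :: "real^'d \<Rightarrow> complex^'n"
  by (simp add: L2_iff square_integrable_cmult)

lemma transform_surj:
  assumes h: "h \<in> L2"
  obtains f where "f \<in> ell2 (verts G)" "\<And>j m. fiber f j m = torus.coef (\<lambda>\<theta>. h \<theta> $ j) m"
    "L2_eq (transform f) h"
proof -
  \<comment> \<open>A vertex determines its \<open>j\<close> and its lattice vector, recovered here
    by \<open>inv v\<close> of the cell part and by the integer part; the value 0 elsewhere is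
    demanded by \<open>ell2\<close>.\<close>
  define f where "f x = (if x \<in> verts G
    then torus.coef (\<lambda>\<theta>. h \<theta> $ (inv v (cell_part a p x))) (int_part a p x) else 0)" for x
  have fiber: "fiber f j m = torus.coef (\<lambda>\<theta>. h \<theta> $ j) m" for j m
  proof -
    have "inv v (v j) = j"
      by (rule inv_f_f) (auto simp: inj_on_def v_eq_iff)
    then show ?thesis
      by (simp add: fiber_def f_def verts_shift v_in_verts cell_part_v int_part_v)
  qed
  have f: "f \<in> ell2 (verts G)"
    unfolding ell2_verts_iff fiber using h by (auto simp: f_def L2_iff intro: torus.summable_coef)
  moreover have "L2_eq (transform f) h"
    using f h by (intro L2_eq_if_coef_eq transform_L2) (simp_all add: coef_transform fiber)
  ultimately show ?thesis
    using that fiber by blast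
qed

lemma unitary_transform: "unitary_ell2_L2 (verts G) transform"
  unfolding unitary_ell2_L2_def
proof (intro conjI ballI allI)
  fix f assume f: "f \<in> ell2 (verts G)"
  show "transform f \<in> L2"
    using f by (rule transform_L2)
  show "L2_eq (transform (\<lambda>x. c * f x)) (\<lambda>\<theta>. c *s transform f \<theta>)" for c
    using f by (intro L2_eq_if_coef_eq L2_cmult transform_L2 ell2_cmult)
      (simp_all add: coef_transform ell2_cmult torus.coef_cmult fiber_def)
  fix g assume g: "g \<in> ell2 (verts G)"
  show "L2_eq (transform (\<lambda>x. f x + g x)) (\<lambda>\<theta>. transform f \<theta> + transform g \<theta>)"
  proof (intro L2_eq_if_coef_eq L2_add transform_L2 ell2_add f g)
    fix j m
    show "torus.coef (\<lambda>\<theta>. transform (\<lambda>x. f x + g x) \<theta> $ j) m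
        = torus.coef (\<lambda>\<theta>. (transform f \<theta> + transform g \<theta>) $ j) m"
      using transform_L2[OF f] transform_L2[OF g]
      by (simp add: coef_transform ell2_add f g torus.coef_add L2_iff) (simp add: fiber_def)
  qed
  show "L2_inner (transform f) (transform g) = ell2_inner (verts G) f g"
  proof -
    have sq: "square_integrable torus_measure (\<lambda>\<theta>. transform f \<theta> $ j)"
      "square_integrable torus_measure (\<lambda>\<theta>. transform g \<theta> $ j)" for j
      using transform_L2[OF f] transform_L2[OF g] by (auto simp: L2_iff)
    have "((\<lambda>x. f x * cnj (g x)) has_sum
        (\<Sum>j\<in>UNIV. \<integral>\<theta>. transform f \<theta> $ j * cnj (transform g \<theta> $ j) \<partial>torus_measure)) (verts G)"
    proof (rule has_sum_verts)
      fix j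
      show "((\<lambda>m. f (v j + lattice_vec a m) * cnj (g (v j + lattice_vec a m))) has_sum
          (\<integral>\<theta>. transform f \<theta> $ j * cnj (transform g \<theta> $ j) \<partial>torus_measure)) UNIV"
        using torus.parseval_inner[OF sq, of j] by (simp add: coef_transform f g fiber_def)
    qed
    moreover have "L2_inner (transform f) (transform g)
        = (\<Sum>j\<in>UNIV. \<integral>\<theta>. transform f \<theta> $ j * cnj (transform g \<theta> $ j) \<partial>torus_measure)"
      unfolding L2_inner_def by (rule Bochner_Integration.integral_sum) (intro integrable_mult_cnj sq)
    ultimately show ?thesis
      unfolding ell2_inner_def by (simp add: infsumI)
  qed
next
  fix h :: "real^'d \<Rightarrow> complex^'n" assume "h \<in> L2"
  then show "\<exists>f\<in>ell2 (verts G). L2_eq (transform f) h"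
    using transform_surj by blast
qed

text \<open>The description in \<open>inverse_op\<close> is unique: equality in \<open>L2\<close>
  fixes the coefficients, hence all values on vertices, and elements of \<open>ell2\<close> vanish
  elsewhere.\<close>

lemma transform_inverse_op:
  assumes h: "h \<in> L2"
  shows "inverse_op (verts G) transform h \<in> ell2 (verts G)"
    and "fiber (inverse_op (verts G) transform h) j m = torus.coef (\<lambda>\<theta>. h \<theta> $ j) m"
proof -
  obtain f where f: "f \<in> ell2 (verts G)" "\<And>j m. fiber f j m = torus.coef (\<lambda>\<theta>. h \<theta> $ j) m"
    "L2_eq (transform f) h"
    using transform_surj[OF h] by blast
  have "inverse_op (verts G) transform h = f"
    unfolding inverse_op_def
  proof (rule the_equality)
    fix f' assume f': "f' \<in> ell2 (verts G) \<and> L2_eq (transform f') h"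
    then have "fiber f' j m = fiber f j m" for j m
      using coef_cong_L2_eq[OF transform_L2 h, of f'] by (simp add: coef_transform f(2))
    then have "f' x = f x" if "x \<in> verts G" for x
      using that unfolding verts_eq_UN fiber_def by auto
    moreover have "f' x = f x" if "x \<notin> verts G" for x
      using that f' f(1) by (simp add: ell2_def)
    ultimately show "f' = f"
      by blast
  qed (use f in auto)
  then show "inverse_op (verts G) transform h \<in> ell2 (verts G)"
    "fiber (inverse_op (verts G) transform h) j m = torus.coef (\<lambda>\<theta>. h \<theta> $ j) m"
    using f by auto
qed

section \<open>The Schroedinger operator as multiplication by the Floquet matrix\<close>

lemma sum_arcs_from_v: "(\<Sum>e\<in>arcs_from G (v j). F e) = (\<Sum>k\<in>UNIV. \<Sum>e\<in>arcs_to_orbit p (v j) (v k). F e)"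
proof -
  let ?k = "\<lambda>e. inv v (cell_part a p (head G e))"
  have inv: "inv v (v k) = k" for k
    by (rule inv_f_f) (auto simp: inj_on_def v_eq_iff)
  have "arcs_to_orbit p (v j) (v k) = {e \<in> arcs_from G (v j). ?k e = k}" for k
  proof -
    have "?k e = k \<longleftrightarrow> cell_part a p (head G e) = v k" if "e \<in> arcs_from G (v j)" for e
    proof -
      have "head G e \<in> verts G"
        using that by (auto simp: arcs_from_def)
      then obtain l where "cell_part a p (head G e) = v l"
        by (rule vertex_cases)
      then show ?thesis
        by (simp add: inv v_eq_iff)
    qed
    then show ?thesis
      by (auto simp: arcs_to_orbit_def)
  qed
  then show ?thesis
    using sum.group[OF finite_arcs_from[of "v j"] finite_class.finite_UNIV, of ?k F] by simp
qed

lemma floquet_matrix_entry: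
  "floquet_matrix G arev a shift Q p v \<theta> $ j $ k
    = (if j = k then of_nat (degree G arev (v j)) + of_real (Q (v j)) else 0)
      - (\<Sum>e\<in>arcs_to_orbit p (v j) (v k). character (int_part a p (head G e)) \<theta>)"
  by (simp add: floquet_matrix_def floquet_laplacian_entry[where v = v, OF v_in_cell])

lemma floquet_matrix_mult_component:
  "(floquet_matrix G arev a shift Q p v \<theta> *v z) $ j
    = (of_nat (degree G arev (v j)) + of_real (Q (v j))) * z $ j
      - (\<Sum>k\<in>UNIV. \<Sum>e\<in>arcs_to_orbit p (v j) (v k). character (int_part a p (head G e)) \<theta> * z $ k)"
  by (simp add: matrix_vector_mult_def floquet_matrix_entry left_diff_distrib sum_subtractf
      sum_distrib_right if_distrib[of "\<lambda>x. x * _"] cong: if_cong)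

lemma floquet_matrix_L2:
  assumes "g \<in> L2"
  shows "direct_integral_op (floquet_matrix G arev a shift Q p v) g \<in> L2"
  using assms unfolding L2_iff direct_integral_op_def floquet_matrix_mult_component
  by (intro allI square_integrable_diff square_integrable_sum square_integrable_cmult
      square_integrable_character_mult) auto

text \<open>The Fourier coefficients of the multiplication by \<open>H(\<theta>)\<close> are those of the operator \<open>H\<close>,
  because multiplication by \<open>character \<tau>\<close> shifts the coefficients by \<open>\<tau>\<close>.\<close>

lemma coef_floquet_matrix:
  assumes g: "g \<in> L2" and f: "\<And>j m. fiber f j m = torus.coef (\<lambda>\<theta>. g \<theta> $ j) m"
  shows "torus.coef (\<lambda>\<theta>. direct_integral_op (floquet_matrix G arev a shift Q p v) g \<theta> $ j) m
    = fiber (schroedinger G arev Q f) j m"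
proof -
  let ?d = "of_nat (degree G arev (v j)) + complex_of_real (Q (v j))"
  have sq: "square_integrable torus_measure (\<lambda>\<theta>. g \<theta> $ k)" for k
    using g by (simp add: L2_iff)
  note sq' = square_integrable_character_mult[OF sq]
  have "torus.coef (\<lambda>\<theta>. direct_integral_op (floquet_matrix G arev a shift Q p v) g \<theta> $ j) m
      = ?d * torus.coef (\<lambda>\<theta>. g \<theta> $ j) m
        - (\<Sum>k\<in>UNIV. \<Sum>e\<in>arcs_to_orbit p (v j) (v k). torus.coef (\<lambda>\<theta>. g \<theta> $ k) (m + int_part a p (head G e)))"
    unfolding direct_integral_op_def floquet_matrix_mult_component
    by (simp add: torus.coef_diff torus.coef_sum torus.coef_cmult coef_character_mult
        square_integrable_cmult square_integrable_sum sq sq')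
  also have "\<dots> = ?d * fiber f j m
      - (\<Sum>k\<in>UNIV. \<Sum>e\<in>arcs_to_orbit p (v j) (v k). fiber f k (m + int_part a p (head G e)))"
    by (simp only: f)
  also have "(\<Sum>k\<in>UNIV. \<Sum>e\<in>arcs_to_orbit p (v j) (v k). fiber f k (m + int_part a p (head G e)))
      = (\<Sum>k\<in>UNIV. \<Sum>e\<in>arcs_to_orbit p (v j) (v k). f (head G e + lattice_vec a m))"
  proof (intro sum.cong refl)
    fix k e assume "e \<in> arcs_to_orbit p (v j) (v k)"
    then obtain i where i: "int_part a p (head G e) = i" "head G e = v k + lattice_vec a i"
      using head_arcs_to_orbit by blast
    show "fiber f k (m + int_part a p (head G e)) = f (head G e + lattice_vec a m)"
      unfolding fiber_def lattice_vec_add i(1) unfolding i(2) by (simp add: ac_simps)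
  qed
  also have "\<dots> = (\<Sum>e\<in>arcs_from G (v j). f (head G e + lattice_vec a m))"
    by (rule sum_arcs_from_v[symmetric])
  also have "?d * fiber f j m - \<dots> = fiber (schroedinger G arev Q f) j m"
    by (simp add: fiber_def schroedinger_def laplacian_add_lattice Q_periodic v_in_verts algebra_simps)
  finally show ?thesis .
qed

text \<open>No norm estimate is made: by \<open>coef_floquet_matrix\<close> the values of
  \<open>schroedinger G arev Q f\<close> on an orbit are the Fourier coefficients of a square
  integrable function, hence square summable by Bessel's inequality.\<close>

lemma schroedinger_ell2:
  assumes f: "f \<in> ell2 (verts G)"
  shows "schroedinger G arev Q f \<in> ell2 (verts G)"
  unfolding ell2_verts_iff
proof (intro conjI allI impI)
  fix x assume x: "x \<notin> verts G"
  then have "arcs_from G x = {}"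
    by (auto simp: arcs_from_def)
  then show "schroedinger G arev Q f x = 0"
    using x f by (simp add: schroedinger_def laplacian_eq_sum_arcs_from ell2_def)
next
  fix j
  have "(\<lambda>m. (cmod (torus.coef (\<lambda>\<theta>. direct_integral_op (floquet_matrix G arev a shift Q p v) (transform f) \<theta> $ j) m))\<^sup>2)
      summable_on UNIV"
    using floquet_matrix_L2[OF transform_L2[OF f]] by (intro torus.summable_coef) (simp add: L2_iff)
  then show "(\<lambda>m. (cmod (fiber (schroedinger G arev Q f) j m))\<^sup>2) summable_on UNIV"
    by (simp add: coef_floquet_matrix[OF transform_L2[OF f] coef_transform[OF f, symmetric]])
qed

lemma transform_schroedinger:
  assumes g: "g \<in> L2"
  shows "L2_eq (transform (schroedinger G arev Q (inverse_op (verts G) transform g)))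
    (direct_integral_op (floquet_matrix G arev a shift Q p v) g)"
  using schroedinger_ell2[OF transform_inverse_op(1)[OF g]]
  by (intro L2_eq_if_coef_eq transform_L2 floquet_matrix_L2 g)
    (simp_all add: coef_transform coef_floquet_matrix[OF g transform_inverse_op(2)[OF g]])

text \<open>With \<open>n l\<close> the integer part of \<open>v l\<close> for the new origin, every
  arc from orbit \<open>j\<close> to orbit \<open>k\<close> changes its index by
  \<open>n k - n j\<close>, so the characters factor out of the sum. For \<open>j = k\<close> they
  cancel, which leaves degree and potential alone.\<close>

lemma change_of_origin:
  "floquet_matrix G arev a shift Q p1 (\<lambda>j. cell_part a p1 (v j)) \<theta> $ j $ k
    = character (- int_part a p1 (v j)) \<theta> * floquet_matrix G arev a shift Q p v \<theta> $ j $ k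
      * character (int_part a p1 (v k)) \<theta>"
proof -
  define n where "n l = int_part a p1 (v l)" for l
  define w where "w l = cell_part a p1 (v l)" for l
  have w: "w l = v l + lattice_vec a (- n l)" for l
    by (simp add: w_def n_def cell_part_def lattice_vec_minus)
  have w_cell: "w l \<in> cell a p1" for l
    by (simp add: w_def cell_iff int_part_cell_part)
  have w_eq_iff: "w l = w k \<longleftrightarrow> l = k" for l k
    using cell_part_v[of l "- n l"] cell_part_v[of k "- n k"] v_eq_iff by (metis w)
  \<comment> \<open>The new representative of orbit \<open>j\<close> is \<open>v j\<close> moved by
    \<open>- n j\<close>, so its arcs are those of \<open>v j\<close> moved likewise; which orbit a
    head belongs to does not depend on the origin.\<close>
  have arcs: "arcs_to_orbit p1 (w j) (w k) = shift (- n j) ` arcs_to_orbit p (v j) (v k)"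
  proof -
    have "cell_part a p1 (head G (shift (- n j) e)) = w k \<longleftrightarrow> cell_part a p (head G e) = v k"
      if e: "e \<in> arcs_from G (v j)" for e
    proof -
      have eG: "e \<in> arcs G"
        using e by (simp add: arcs_from_def)
      then obtain l where l: "cell_part a p (head G e) = v l"
        using vertex_cases[OF head_in_verts] by blast
      then have "head G e = v l + lattice_vec a (int_part a p (head G e))"
        using cell_part_add_int_part[of p "head G e"] by simp
      then have "cell_part a p1 (head G e) = w l"
        by (metis cell_part_add_lattice w_def)
      then show ?thesis
        using eG l by (simp add: head_shift cell_part_add_lattice w_eq_iff v_eq_iff)
    qed
    then show ?thesis
      unfolding arcs_to_orbit_def w[of j] arcs_from_add_lattice by auto
  qed
  have index: "int_part a p1 (head G (shift (- n j) e)) = - n j + int_part a p (head G e) + n k"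
    if e: "e \<in> arcs_to_orbit p (v j) (v k)" for e
  proof -
    have "e \<in> arcs G"
      using e by (simp add: arcs_to_orbit_def arcs_from_def)
    then have "head G (shift (- n j) e) = v k + lattice_vec a (int_part a p (head G e) + - n j)"
      unfolding head_shift[OF \<open>e \<in> arcs G\<close>] lattice_vec_add
      by (subst head_arcs_to_orbit[OF e]) (simp only: add.assoc)
    then show ?thesis
      by (simp add: int_part_add_lattice n_def)
  qed
  have inj: "inj_on (shift (- n j)) (arcs_to_orbit p (v j) (v k))"
    by (rule inj_on_subset[OF inj_on_shift]) (auto simp: arcs_to_orbit_def arcs_from_def)
  have "(\<Sum>e\<in>arcs_to_orbit p1 (w j) (w k). character (int_part a p1 (head G e)) \<theta>)
      = (\<Sum>e\<in>arcs_to_orbit p (v j) (v k). character (- n j + int_part a p (head G e) + n k) \<theta>)"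
    unfolding arcs by (simp add: sum.reindex[OF inj] index)
  also have "\<dots> = character (- n j) \<theta>
      * (\<Sum>e\<in>arcs_to_orbit p (v j) (v k). character (int_part a p (head G e)) \<theta>) * character (n k) \<theta>"
    unfolding character_add sum_distrib_left sum_distrib_right ..
  finally have sum: "(\<Sum>e\<in>arcs_to_orbit p1 (w j) (w k). character (int_part a p1 (head G e)) \<theta>) = \<dots>" .
  have "character (- n j) \<theta> * character (n j) \<theta> = 1"
    by (simp flip: character_add)
  then have diag: "character (- n j) \<theta> * c * character (n j) \<theta> = c" for c
    by (metis mult.assoc mult.commute mult_1)
  have "degree G arev (w l) = degree G arev (v l)" "Q (w l) = Q (v l)" for l
    by (simp_all only: w degree_add_lattice Q_periodic v_in_verts)
  then have "floquet_matrix G arev a shift Q p1 w \<theta> $ j $ k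
      = (if j = k then of_nat (degree G arev (v j)) + of_real (Q (v j)) else 0)
        - (\<Sum>e\<in>arcs_to_orbit p1 (w j) (w k). character (int_part a p1 (head G e)) \<theta>)"
    by (simp add: floquet_matrix_def floquet_laplacian_entry[where v = w, OF w_cell])
  also have "\<dots> = character (- n j) \<theta> * floquet_matrix G arev a shift Q p v \<theta> $ j $ k * character (n k) \<theta>"
  proof (cases "j = k")
    case True
    show ?thesis
      unfolding sum floquet_matrix_entry right_diff_distrib left_diff_distrib
      using True diag by simp
  next
    case False
    then show ?thesis
      unfolding sum floquet_matrix_entry by simp
  qed
  finally show ?thesis
    unfolding n_def w_def[abs_def] .
qed

lemma floquet_matrix_unitarily_equivalent:
  "unitarily_equivalent (floquet_matrix G arev a shift Q p1 (\<lambda>j. cell_part a p1 (v j)) \<theta>)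
    (floquet_matrix G arev a shift Q p v \<theta>)"
proof -
  define n where "n j = int_part a p1 (v j)" for j
  \<comment> \<open>\<open>change_of_origin\<close> gives the matrix at \<open>p1\<close>; solving
    for the one at \<open>p\<close> moves the characters to the other side, hence \<open>n j\<close>
    without the minus sign.\<close>
  define W :: "complex^'n^'n" where "W = (\<chi> j k. if j = k then character (n j) \<theta> else 0)"
  have W': "conj_transpose W = (\<chi> j k. if j = k then character (- n j) \<theta> else 0)"
    by (auto simp: conj_transpose_def W_def vec_eq_iff cnj_character)
  have mult_diag: "((\<chi> j k. if j = k then d j else 0) ** A) $ j $ k = d j * A $ j $ k"
    "(A ** (\<chi> j k. if j = k then d j else 0)) $ j $ k = A $ j $ k * d k"
    for d and A :: "complex^'n^'n" and j k
    by (simp_all add: matrix_matrix_mult_def if_distrib[of "\<lambda>x. x * _"] if_distrib[of "\<lambda>x. _ * x"] cong: if_cong)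
  have chars: "character (m :: int^'d) \<theta> * character (- m) \<theta> = 1" "character (- m) \<theta> * character m \<theta> = 1" for m
    by (simp_all flip: character_add)
  have "W ** conj_transpose W = mat 1" "conj_transpose W ** W = mat 1"
    unfolding W' unfolding W_def by (auto simp: vec_eq_iff mult_diag chars mat_def)
  moreover have "floquet_matrix G arev a shift Q p v \<theta>
      = W ** floquet_matrix G arev a shift Q p1 (\<lambda>j. cell_part a p1 (v j)) \<theta> ** conj_transpose W"
  proof -
    have "floquet_matrix G arev a shift Q p v \<theta> $ j $ k
      = character (n j) \<theta> * (character (- n j) \<theta> * floquet_matrix G arev a shift Q p v \<theta> $ j $ k
        * character (n k) \<theta>) * character (- n k) \<theta>" for j k
      using chars[of "n j"] chars[of "n k"] by (simp add: mult.assoc)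
    then show ?thesis
      unfolding W' unfolding W_def by (simp add: vec_eq_iff mult_diag change_of_origin n_def)
  qed
  ultimately show ?thesis
    unfolding unitarily_equivalent_def by blast
qed

section \<open>Bridges and non-constant entries\<close>

lemma floquet_laplacian_constant_on_iff:
  "(\<lambda>\<theta>. floquet_laplacian G arev a shift p v \<theta> $ j $ k) constant_on torus \<longleftrightarrow>
    \<not> (\<exists>E\<in>arcs_between (fundamental_graph G a shift p) (v j) (v k). orbit_index G a p E \<noteq> 0)"
proof -
  have "(\<forall>E\<in>arcs_between (fundamental_graph G a shift p) (v j) (v k). orbit_index G a p E = 0)
      \<longleftrightarrow> (\<forall>e\<in>arcs_to_orbit p (v j) (v k). int_part a p (head G e) = 0)"
    unfolding bij_betw_imp_surj_on[OF bij_betw_arc_orbit[OF v_in_cell], symmetric]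
    using orbit_index_arc_orbit[OF v_in_cell] by (auto simp: arcs_to_orbit_def)
  then show ?thesis
    unfolding floquet_laplacian_entry[where v = v, OF v_in_cell]
    by (simp add: sum_character_constant_on_iff finite_arcs_to_orbit)
qed

text \<open>The reversed arc is a bridge from \<open>k\<close> to \<open>j\<close>; whichever of
  \<open>j \<le> k\<close> and \<open>k \<le> j\<close> holds, one of the two arcs witnesses a
  non-constant entry on or above the diagonal.\<close>

lemma exists_fundamental_bridge:
  obtains j k E E' where
    "E \<in> arcs_between (fundamental_graph G a shift p) (v j) (v k)" "orbit_index G a p E \<noteq> 0"
    "E' \<in> arcs_between (fundamental_graph G a shift p) (v k) (v j)" "orbit_index G a p E' \<noteq> 0"
proof -
  obtain e where e: "e \<in> arcs G" "int_part a p (head G e) \<noteq> int_part a p (tail G e)"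
    by (rule exists_bridge)
  obtain j where j: "cell_part a p (tail G e) = v j"
    using vertex_cases[OF tail_in_verts[OF e(1)]] .
  obtain k where k: "cell_part a p (head G e) = v k"
    using vertex_cases[OF head_in_verts[OF e(1)]] .
  have "arc_orbit shift e' \<in> arcs (fundamental_graph G a shift p)" if "e' \<in> arcs G" for e'
    using that by (simp add: fundamental_graph_def)
  then show ?thesis
    using e j k
    by (intro that[of "arc_orbit shift e" j k "arc_orbit shift (arev e)"])
      (auto simp: arcs_between_def tail_fundamental_graph head_fundamental_graph orbit_index_eq edge_index_def)
qed

end

theorem theorem1p1:
  fixes G :: "(real^'d, 'e) pre_digraph"
    and arev :: "'e \<Rightarrow> 'e"
    and a :: "'d \<Rightarrow> real^'d"
    and shift :: "int^'d \<Rightarrow> 'e \<Rightarrow> 'e"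
    and p :: "real^'d"
    and v :: "'n::{finite,linorder} \<Rightarrow> real^'d"
    and Q :: "real^'d \<Rightarrow> real"
  assumes "CARD('d) \<ge> 2"
    and "periodic_graph G arev a shift"
    and "bij_betw v UNIV (verts (fundamental_graph G a shift p))"
    and "\<And>x m. x \<in> verts G \<Longrightarrow> Q (x + lattice_vec a m) = Q x"
  shows
    "((\<forall>f\<in>ell2 (verts G). schroedinger G arev Q f \<in> ell2 (verts G)) \<and>
      (\<exists>U.
         unitary_ell2_L2 (verts G) U \<and>
         (\<forall>g\<in>L2. L2_eq (U (schroedinger G arev Q (inverse_op (verts G) U g)))
            (direct_integral_op (floquet_matrix G arev a shift Q p v) g))))
     \<and>
     (\<forall>p1. \<forall>\<theta>\<in>torus. unitarily_equivalent
        (floquet_matrix G arev a shift Q p1 (\<lambda>j. cell_part a p1 (v j)) \<theta>)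
        (floquet_matrix G arev a shift Q p v \<theta>))
     \<and>
     (\<forall>j k. (\<lambda>\<theta>. floquet_laplacian G arev a shift p v \<theta> $ j $ k) constant_on torus \<longleftrightarrow>
        \<not> (\<exists>E\<in>arcs_between (fundamental_graph G a shift p) (v j) (v k).
              orbit_index G a p E \<noteq> 0))
     \<and>
     (\<exists>j k. j \<le> k \<and>
        \<not> (\<lambda>\<theta>. floquet_laplacian G arev a shift p v \<theta> $ j $ k) constant_on torus)"
proof -
  interpret floquet_graph G arev a shift p v Q
    using assms by (simp add: floquet_graph_def floquet_graph_axioms_def)
  obtain j k E E' where
    "E \<in> arcs_between (fundamental_graph G a shift p) (v j) (v k)" "orbit_index G a p E \<noteq> 0"
    "E' \<in> arcs_between (fundamental_graph G a shift p) (v k) (v j)" "orbit_index G a p E' \<noteq> 0"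
    by (rule exists_fundamental_bridge)
  then have "\<exists>j k. j \<le> k \<and> \<not> (\<lambda>\<theta>. floquet_laplacian G arev a shift p v \<theta> $ j $ k) constant_on torus"
    unfolding floquet_laplacian_constant_on_iff by (metis linear)
  then show ?thesis
    using schroedinger_ell2 unitary_transform transform_schroedinger
      floquet_matrix_unitarily_equivalent floquet_laplacian_constant_on_iff by blast
qed

end
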